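(* Let $(A,\mathcal{L})$ be a polarized abelian threefold over $\mathbb{C}$ of type $(1,d_2,d_3)$ with period matrix $(D\;Z)$, where $D=\mathrm{diag}(1,d_2,d_3)$ and $Z=(\tau_{ij})_{1\le i,j\le3}\in\mathcal{H}_3$. Then $A$ contains an elliptic curve (as an abelian subvariety) if and only if there exists a vector $(a_{ij})_{1\le i<j\le6}\in\mathbb{Q}^{15}$ satisfying the following nine equations. (1) $0=-a_{16}d_2d_3\tau_{11}+a_{14}d_2d_3\tau_{13}+a_{46}d_2d_3-a_{26}d_3\tau_{12}-a_{36}d_2\tau_{13}+a_{24}d_3\tau_{23}+a_{34}d_2\tau_{33}-(d_3\tau_{12}\tau_{13}-d_3\tau_{11}\tau_{23})a_{12}-(d_2\tau_{13}^2-d_2\tau_{11}\tau_{33})a_{13}-(\tau_{13}\tau_{23}-\tau_{12}\tau_{33})a_{23}$ (2) $0=-a_{16}d_2d_3\tau_{12}+a_{15}d_2d_3\tau_{13}+a_{56}d_2d_3-a_{26}d_3\tau_{22}-a_{36}d_2\tau_{23}+a_{25}d_3\tau_{23}+a_{35}d_2\tau_{33}-(d_3\tau_{13}\tau_{22}-d_3\tau_{12}\tau_{23})a_{12}-(d_2\tau_{13}\tau_{23}-d_2\tau_{12}\tau_{33})a_{13}-(\tau_{23}^2-\tau_{22}\tau_{33})a_{23}$ (3) $0=a_{56}d_2\tau_{13}-a_{46}d_2\tau_{23}+a_{45}d_2\tau_{33}-\big((\tau_{23}^2-\tau_{22}\tau_{33})\tau_{11}-(\tau_{13}\tau_{23}-\tau_{12}\tau_{33})\tau_{12}+(\tau_{13}\tau_{22}-\tau_{12}\tau_{23})\tau_{13}\big)a_{12}-(d_2\tau_{13}\tau_{23}-d_2\tau_{12}\tau_{33})a_{14}+(d_2\tau_{13}^2-d_2\tau_{11}\tau_{33})a_{15}-(d_2\tau_{12}\tau_{13}-d_2\tau_{11}\tau_{23})a_{16}-(\tau_{23}^2-\tau_{22}\tau_{33})a_{24}+(\tau_{13}\tau_{23}-\tau_{12}\tau_{33})a_{25}-(\tau_{13}\tau_{22}-\tau_{12}\tau_{23})a_{26}$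 (4) $0=-a_{15}d_2d_3\tau_{11}+a_{14}d_2d_3\tau_{12}+a_{45}d_2d_3-a_{25}d_3\tau_{12}-a_{35}d_2\tau_{13}+a_{24}d_3\tau_{22}+a_{34}d_2\tau_{23}-(d_3\tau_{12}^2-d_3\tau_{11}\tau_{22})a_{12}-(d_2\tau_{12}\tau_{13}-d_2\tau_{11}\tau_{23})a_{13}-(\tau_{13}\tau_{22}-\tau_{12}\tau_{23})a_{23}$ (5) $0=a_{56}d_2d_3\tau_{11}-a_{46}d_2d_3\tau_{12}+a_{45}d_2d_3\tau_{13}-\big((\tau_{23}^2-\tau_{22}\tau_{33})\tau_{11}-(\tau_{13}\tau_{23}-\tau_{12}\tau_{33})\tau_{12}+(\tau_{13}\tau_{22}-\tau_{12}\tau_{23})\tau_{13}\big)a_{23}+(d_3\tau_{13}\tau_{22}-d_3\tau_{12}\tau_{23})a_{24}-(d_3\tau_{12}\tau_{13}-d_3\tau_{11}\tau_{23})a_{25}+(d_3\tau_{12}^2-d_3\tau_{11}\tau_{22})a_{26}+(d_2\tau_{13}\tau_{23}-d_2\tau_{12}\tau_{33})a_{34}-(d_2\tau_{13}^2-d_2\tau_{11}\tau_{33})a_{35}+(d_2\tau_{12}\tau_{13}-d_2\tau_{11}\tau_{23})a_{36}$ (6) $0=-a_{56}d_3\tau_{12}+a_{46}d_3\tau_{22}-a_{45}d_3\tau_{23}-\big((\tau_{23}^2-\tau_{22}\tau_{33})\tau_{11}-(\tau_{13}\tau_{23}-\tau_{12}\tau_{33})\tau_{12}+(\tau_{13}\tau_{22}-\tau_{12}\tau_{23})\tau_{13}\big)a_{13}+(d_3\tau_{13}\tau_{22}-d_3\tau_{12}\tau_{23})a_{14}-(d_3\tau_{12}\tau_{13}-d_3\tau_{11}\tau_{23})a_{15}+(d_3\tau_{12}^2-d_3\tau_{11}\tau_{22})a_{16}-(\tau_{23}^2-\tau_{22}\tau_{33})a_{34}+(\tau_{13}\tau_{23}-\tau_{12}\tau_{33})a_{35}-(\tau_{13}\tau_{22}-\tau_{12}\tau_{23})a_{36}$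 (7) $d_2d_3=-a_{14}d_2d_3-a_{36}d_2-a_{25}d_3$ (8) $0=-2a_{16}a_{34}d_2-2a_{13}a_{46}d_2-2a_{15}a_{24}d_3-2a_{12}a_{45}d_3+(a_{36}d_2+a_{25}d_3)a_{14}+(a_{14}d_3+a_{36})a_{25}-2a_{26}a_{35}+(a_{14}d_2+a_{25})a_{36}-2a_{23}a_{56}$ (9) $0=(a_{36}a_{45}-a_{35}a_{46}+a_{34}a_{56})a_{12}-(a_{26}a_{45}-a_{25}a_{46}+a_{24}a_{56})a_{13}+(a_{26}a_{35}-a_{25}a_{36}+a_{23}a_{56})a_{14}-(a_{26}a_{34}-a_{24}a_{36}+a_{23}a_{46})a_{15}+(a_{25}a_{34}-a_{24}a_{35}+a_{23}a_{45})a_{16}+(a_{16}a_{45}-a_{15}a_{46}+a_{14}a_{56})a_{23}-(a_{16}a_{35}-a_{15}a_{36}+a_{13}a_{56})a_{24}+(a_{16}a_{34}-a_{14}a_{36}+a_{13}a_{46})a_{25}-(a_{15}a_{34}-a_{14}a_{35}+a_{13}a_{45})a_{26}+(a_{16}a_{25}-a_{15}a_{26}+a_{12}a_{56})a_{34}-(a_{16}a_{24}-a_{14}a_{26}+a_{12}a_{46})a_{35}+(a_{15}a_{24}-a_{14}a_{25}+a_{12}a_{45})a_{36}+(a_{16}a_{23}-a_{13}a_{26}+a_{12}a_{36})a_{45}-(a_{15}a_{23}-a_{13}a_{25}+a_{12}a_{35})a_{46}+(a_{14}a_{23}-a_{13}a_{24}+a_{12}a_{34})a_{56}$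
   Context: $d_2,d_3$ are positive integers with $d_2\mid d_3$. $\mathcal{H}_3$ is the Siegel upper half space of symmetric complex $3\times3$ matrices with positive definite imaginary part. That $(A,\mathcal{L})$ has period matrix $(D\;Z)$ means $A=V/\Lambda$ where, for suitable bases of the complex vector space $V$ and a symplectic basis of the lattice $\Lambda$ (for the polarization $\mathcal{L}$), the columns of $(D\;Z)$ are the coordinates of the lattice basis; i.e. $A\cong\mathbb{C}^3/(D\mathbb{Z}^3+Z\mathbb{Z}^3)$ with its standard polarization of type $(1,d_2,d_3)$. *)

theory Defs
  imports "HOL-Analysis.Analysis" "HOL-Algebra.Coset"
begin

definition lattice_basis :: "'v::euclidean_space set \<Rightarrow> 'v set \<Rightarrow> bool" where
  "lattice_basis B \<Lambda> \<longleftrightarrow>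
     independent B \<and> span B = UNIV \<and>
     \<Lambda> = range (\<lambda>c :: 'v \<Rightarrow> int. \<Sum>b\<in>B. of_int (c b) *\<^sub>R b)"

definition is_lattice :: "'v::euclidean_space set \<Rightarrow> bool" where
  "is_lattice \<Lambda> \<longleftrightarrow> (\<exists>B. lattice_basis B \<Lambda>)"

definition additive_group :: "'v::ab_group_add monoid" where
  "additive_group = \<lparr>carrier = UNIV, mult = (+), one = 0\<rparr>"

definition torus :: "'v::euclidean_space set \<Rightarrow> 'v set monoid" where
  "torus \<Lambda> = additive_group Mod \<Lambda>"

definition torus_proj :: "'v::euclidean_space set \<Rightarrow> 'v \<Rightarrow> 'v set" where
  "torus_proj \<Lambda> v = \<Lambda> #>\<^bsub>additive_group\<^esub> v"

(* The charts of a torus are the local inverses of the covering V -> V/Lambda, so a map is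
   holomorphic iff it lifts, locally on the source, to a holomorphic map of the covering spaces. *)
definition holomorphic_torus_map ::
    "complex set \<Rightarrow> (complex ^ 'n) set \<Rightarrow> (complex set \<Rightarrow> (complex ^ 'n) set) \<Rightarrow> bool" where
  "holomorphic_torus_map \<Lambda>' \<Lambda> \<phi> \<longleftrightarrow>
     (\<forall>z0. \<exists>U g. open U \<and> z0 \<in> U \<and> (\<forall>i. (\<lambda>z. g z $ i) holomorphic_on U) \<and>
        (\<forall>z\<in>U. \<phi> (torus_proj \<Lambda>' z) = torus_proj \<Lambda> (g z)))"

(* E is the image of a one-dimensional complex torus under an injective holomorphic homomorphism;
   the source being compact, such a map is a closed embedding. *)
definition elliptic_curve_in :: "(complex ^ 'n) set \<Rightarrow> (complex ^ 'n) set set \<Rightarrow> bool" where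
  "elliptic_curve_in \<Lambda> E \<longleftrightarrow>
     (\<exists>\<Lambda>' \<phi>. is_lattice \<Lambda>' \<and> \<phi> \<in> hom (torus \<Lambda>') (torus \<Lambda>) \<and>
        inj_on \<phi> (carrier (torus \<Lambda>')) \<and> holomorphic_torus_map \<Lambda>' \<Lambda> \<phi> \<and>
        E = \<phi> ` carrier (torus \<Lambda>'))"

definition hermitian_form :: "(complex ^ 'n \<Rightarrow> complex ^ 'n \<Rightarrow> complex) \<Rightarrow> bool" where
  "hermitian_form H \<longleftrightarrow>
     (\<forall>x y z. H (x + y) z = H x z + H y z) \<and>
     (\<forall>c x y. H (c *s x) y = c * H x y) \<and>
     (\<forall>x y. H y x = cnj (H x y))"

(* A polarization is given by its first Chern class, viewed as a Hermitian form on V whose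
   imaginary part is the alternating Riemann form on the lattice. *)
definition polarization ::
    "(complex ^ 'n) set \<Rightarrow> (complex ^ 'n \<Rightarrow> complex ^ 'n \<Rightarrow> complex) \<Rightarrow> bool" where
  "polarization \<Lambda> H \<longleftrightarrow>
     hermitian_form H \<and> (\<forall>x. x \<noteq> 0 \<longrightarrow> 0 < Re (H x x)) \<and>
     (\<forall>x\<in>\<Lambda>. \<forall>y\<in>\<Lambda>. Im (H x y) \<in> \<int>)"

definition polarized_abelian_variety ::
    "(complex ^ 'n) set \<Rightarrow> (complex ^ 'n \<Rightarrow> complex ^ 'n \<Rightarrow> complex) \<Rightarrow> bool" where
  "polarized_abelian_variety \<Lambda> H \<longleftrightarrow> is_lattice \<Lambda> \<and> polarization \<Lambda> H"

(* Sign convention: H is linear in its first argument, so for l the columns of D and m the columns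
   of Z, positive definiteness of H together with that of Im Z forces Im H(m_i, l_i) to be positive. *)
definition symplectic_basis ::
    "(complex ^ 'n) set \<Rightarrow> (complex ^ 'n \<Rightarrow> complex ^ 'n \<Rightarrow> complex) \<Rightarrow> nat ^ 'n
      \<Rightarrow> ('n \<Rightarrow> complex ^ 'n) \<Rightarrow> ('n \<Rightarrow> complex ^ 'n) \<Rightarrow> bool" where
  "symplectic_basis \<Lambda> H d l m \<longleftrightarrow>
     inj (case_sum l m) \<and> lattice_basis (range (case_sum l m)) \<Lambda> \<and>
     (\<forall>i j. Im (H (l i) (l j)) = 0 \<and> Im (H (m i) (m j)) = 0 \<and>
        Im (H (m i) (l j)) = (if i = j then of_nat (d $ i) else 0))"

definition polarization_type ::
    "(complex ^ 3) set \<Rightarrow> (complex ^ 3 \<Rightarrow> complex ^ 3 \<Rightarrow> complex) \<Rightarrow> nat ^ 3 \<Rightarrow> bool" where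
  "polarization_type \<Lambda> H d \<longleftrightarrow>
     (\<forall>i. 0 < d $ i) \<and> d $ 1 dvd d $ 2 \<and> d $ 2 dvd d $ 3 \<and>
     (\<exists>l m. symplectic_basis \<Lambda> H d l m)"

definition siegel_upper_half_space :: "(complex ^ 'n ^ 'n) set" where
  "siegel_upper_half_space =
     {Z. transpose Z = Z \<and> (\<forall>x :: real ^ 'n. x \<noteq> 0 \<longrightarrow> 0 < x \<bullet> ((\<chi> i j. Im (Z $ i $ j)) *v x))}"

definition diag_matrix :: "nat ^ 'n \<Rightarrow> complex ^ 'n ^ 'n" where
  "diag_matrix d = (\<chi> i j. if i = j then of_nat (d $ i) else 0)"

(* e is a complex basis of V; the columns of (D Z) are the e-coordinates of a symplectic basis. *)
definition has_period_matrix ::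
    "(complex ^ 'n) set \<Rightarrow> (complex ^ 'n \<Rightarrow> complex ^ 'n \<Rightarrow> complex) \<Rightarrow> nat ^ 'n
      \<Rightarrow> complex ^ 'n ^ 'n \<Rightarrow> complex ^ 'n ^ 'n \<Rightarrow> bool" where
  "has_period_matrix \<Lambda> H d D Z \<longleftrightarrow>
     (\<exists>e :: 'n \<Rightarrow> complex ^ 'n. inj e \<and> vec.independent (range e) \<and> vec.span (range e) = UNIV \<and>
        symplectic_basis \<Lambda> H d
          (\<lambda>j. \<Sum>i\<in>UNIV. D $ i $ j *s e i) (\<lambda>j. \<Sum>i\<in>UNIV. Z $ i $ j *s e i))"

(* Only the values a i j with 1 <= i < j <= 6 are used. The indices of tau lie in the type 3,
   where 1, 2, 3 are the three distinct elements. *)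
definition elliptic_equations ::
    "complex \<Rightarrow> complex \<Rightarrow> complex ^ 3 ^ 3 \<Rightarrow> (nat \<Rightarrow> nat \<Rightarrow> complex) \<Rightarrow> bool" where
  "elliptic_equations d2 d3 \<tau> a \<longleftrightarrow>
     (0 = -a 1 6 * d2 * d3 * \<tau>$1$1 + a 1 4 * d2 * d3 * \<tau>$1$3 + a 4 6 * d2 * d3 - a 2 6 * d3 * \<tau>$1$2
         - a 3 6 * d2 * \<tau>$1$3 + a 2 4 * d3 * \<tau>$2$3 + a 3 4 * d2 * \<tau>$3$3
         - (d3 * \<tau>$1$2 * \<tau>$1$3 - d3 * \<tau>$1$1 * \<tau>$2$3) * a 1 2
         - (d2 * \<tau>$1$3 ^ 2 - d2 * \<tau>$1$1 * \<tau>$3$3) * a 1 3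
         - (\<tau>$1$3 * \<tau>$2$3 - \<tau>$1$2 * \<tau>$3$3) * a 2 3) \<and>
     (0 = -a 1 6 * d2 * d3 * \<tau>$1$2 + a 1 5 * d2 * d3 * \<tau>$1$3 + a 5 6 * d2 * d3 - a 2 6 * d3 * \<tau>$2$2
         - a 3 6 * d2 * \<tau>$2$3 + a 2 5 * d3 * \<tau>$2$3 + a 3 5 * d2 * \<tau>$3$3
         - (d3 * \<tau>$1$3 * \<tau>$2$2 - d3 * \<tau>$1$2 * \<tau>$2$3) * a 1 2
         - (d2 * \<tau>$1$3 * \<tau>$2$3 - d2 * \<tau>$1$2 * \<tau>$3$3) * a 1 3
         - (\<tau>$2$3 ^ 2 - \<tau>$2$2 * \<tau>$3$3) * a 2 3) \<and>
     (0 = a 5 6 * d2 * \<tau>$1$3 - a 4 6 * d2 * \<tau>$2$3 + a 4 5 * d2 * \<tau>$3$3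
         - ((\<tau>$2$3 ^ 2 - \<tau>$2$2 * \<tau>$3$3) * \<tau>$1$1 - (\<tau>$1$3 * \<tau>$2$3 - \<tau>$1$2 * \<tau>$3$3) * \<tau>$1$2 + (\<tau>$1$3 * \<tau>$2$2 - \<tau>$1$2 * \<tau>$2$3) * \<tau>$1$3) * a 1 2
         - (d2 * \<tau>$1$3 * \<tau>$2$3 - d2 * \<tau>$1$2 * \<tau>$3$3) * a 1 4
         + (d2 * \<tau>$1$3 ^ 2 - d2 * \<tau>$1$1 * \<tau>$3$3) * a 1 5
         - (d2 * \<tau>$1$2 * \<tau>$1$3 - d2 * \<tau>$1$1 * \<tau>$2$3) * a 1 6
         - (\<tau>$2$3 ^ 2 - \<tau>$2$2 * \<tau>$3$3) * a 2 4 + (\<tau>$1$3 * \<tau>$2$3 - \<tau>$1$2 * \<tau>$3$3) * a 2 5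
         - (\<tau>$1$3 * \<tau>$2$2 - \<tau>$1$2 * \<tau>$2$3) * a 2 6) \<and>
     (0 = -a 1 5 * d2 * d3 * \<tau>$1$1 + a 1 4 * d2 * d3 * \<tau>$1$2 + a 4 5 * d2 * d3 - a 2 5 * d3 * \<tau>$1$2
         - a 3 5 * d2 * \<tau>$1$3 + a 2 4 * d3 * \<tau>$2$2 + a 3 4 * d2 * \<tau>$2$3
         - (d3 * \<tau>$1$2 ^ 2 - d3 * \<tau>$1$1 * \<tau>$2$2) * a 1 2
         - (d2 * \<tau>$1$2 * \<tau>$1$3 - d2 * \<tau>$1$1 * \<tau>$2$3) * a 1 3
         - (\<tau>$1$3 * \<tau>$2$2 - \<tau>$1$2 * \<tau>$2$3) * a 2 3) \<and>
     (0 = a 5 6 * d2 * d3 * \<tau>$1$1 - a 4 6 * d2 * d3 * \<tau>$1$2 + a 4 5 * d2 * d3 * \<tau>$1$3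
         - ((\<tau>$2$3 ^ 2 - \<tau>$2$2 * \<tau>$3$3) * \<tau>$1$1 - (\<tau>$1$3 * \<tau>$2$3 - \<tau>$1$2 * \<tau>$3$3) * \<tau>$1$2 + (\<tau>$1$3 * \<tau>$2$2 - \<tau>$1$2 * \<tau>$2$3) * \<tau>$1$3) * a 2 3
         + (d3 * \<tau>$1$3 * \<tau>$2$2 - d3 * \<tau>$1$2 * \<tau>$2$3) * a 2 4
         - (d3 * \<tau>$1$2 * \<tau>$1$3 - d3 * \<tau>$1$1 * \<tau>$2$3) * a 2 5
         + (d3 * \<tau>$1$2 ^ 2 - d3 * \<tau>$1$1 * \<tau>$2$2) * a 2 6
         + (d2 * \<tau>$1$3 * \<tau>$2$3 - d2 * \<tau>$1$2 * \<tau>$3$3) * a 3 4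
         - (d2 * \<tau>$1$3 ^ 2 - d2 * \<tau>$1$1 * \<tau>$3$3) * a 3 5
         + (d2 * \<tau>$1$2 * \<tau>$1$3 - d2 * \<tau>$1$1 * \<tau>$2$3) * a 3 6) \<and>
     (0 = -a 5 6 * d3 * \<tau>$1$2 + a 4 6 * d3 * \<tau>$2$2 - a 4 5 * d3 * \<tau>$2$3
         - ((\<tau>$2$3 ^ 2 - \<tau>$2$2 * \<tau>$3$3) * \<tau>$1$1 - (\<tau>$1$3 * \<tau>$2$3 - \<tau>$1$2 * \<tau>$3$3) * \<tau>$1$2 + (\<tau>$1$3 * \<tau>$2$2 - \<tau>$1$2 * \<tau>$2$3) * \<tau>$1$3) * a 1 3
         + (d3 * \<tau>$1$3 * \<tau>$2$2 - d3 * \<tau>$1$2 * \<tau>$2$3) * a 1 4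
         - (d3 * \<tau>$1$2 * \<tau>$1$3 - d3 * \<tau>$1$1 * \<tau>$2$3) * a 1 5
         + (d3 * \<tau>$1$2 ^ 2 - d3 * \<tau>$1$1 * \<tau>$2$2) * a 1 6 - (\<tau>$2$3 ^ 2 - \<tau>$2$2 * \<tau>$3$3) * a 3 4
         + (\<tau>$1$3 * \<tau>$2$3 - \<tau>$1$2 * \<tau>$3$3) * a 3 5
         - (\<tau>$1$3 * \<tau>$2$2 - \<tau>$1$2 * \<tau>$2$3) * a 3 6) \<and>
     (d2 * d3 = -a 1 4 * d2 * d3 - a 3 6 * d2 - a 2 5 * d3) \<and>
     (0 = -2 * a 1 6 * a 3 4 * d2 - 2 * a 1 3 * a 4 6 * d2 - 2 * a 1 5 * a 2 4 * d3 - 2 * a 1 2 * a 4 5 * d3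
         + (a 3 6 * d2 + a 2 5 * d3) * a 1 4 + (a 1 4 * d3 + a 3 6) * a 2 5 - 2 * a 2 6 * a 3 5
         + (a 1 4 * d2 + a 2 5) * a 3 6 - 2 * a 2 3 * a 5 6) \<and>
     (0 = (a 3 6 * a 4 5 - a 3 5 * a 4 6 + a 3 4 * a 5 6) * a 1 2 - (a 2 6 * a 4 5 - a 2 5 * a 4 6 + a 2 4 * a 5 6) * a 1 3
         + (a 2 6 * a 3 5 - a 2 5 * a 3 6 + a 2 3 * a 5 6) * a 1 4 - (a 2 6 * a 3 4 - a 2 4 * a 3 6 + a 2 3 * a 4 6) * a 1 5
         + (a 2 5 * a 3 4 - a 2 4 * a 3 5 + a 2 3 * a 4 5) * a 1 6 + (a 1 6 * a 4 5 - a 1 5 * a 4 6 + a 1 4 * a 5 6) * a 2 3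
         - (a 1 6 * a 3 5 - a 1 5 * a 3 6 + a 1 3 * a 5 6) * a 2 4 + (a 1 6 * a 3 4 - a 1 4 * a 3 6 + a 1 3 * a 4 6) * a 2 5
         - (a 1 5 * a 3 4 - a 1 4 * a 3 5 + a 1 3 * a 4 5) * a 2 6 + (a 1 6 * a 2 5 - a 1 5 * a 2 6 + a 1 2 * a 5 6) * a 3 4
         - (a 1 6 * a 2 4 - a 1 4 * a 2 6 + a 1 2 * a 4 6) * a 3 5 + (a 1 5 * a 2 4 - a 1 4 * a 2 5 + a 1 2 * a 4 5) * a 3 6
         + (a 1 6 * a 2 3 - a 1 3 * a 2 6 + a 1 2 * a 3 6) * a 4 5 - (a 1 5 * a 2 3 - a 1 3 * a 2 5 + a 1 2 * a 3 5) * a 4 6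
         + (a 1 4 * a 2 3 - a 1 3 * a 2 4 + a 1 2 * a 3 4) * a 5 6)"

end

theory Submission
  imports Defs
begin

text \<open>
  An elliptic curve in \<open>V / \<Lambda>\<close> is the same as a complex line \<open>\<complex> w\<close> meeting \<open>\<Lambda>\<close> in rank two. Let
  \<open>E = Im H\<close>. Given \<open>z1 w, z2 w \<in> \<Lambda>\<close>, a multiple of the decomposable form
  \<open>E(\<sqdot>, z1 w) \<and> E(\<sqdot>, z2 w)\<close> solves the equations: it has type \<open>(1,1)\<close>, its Pfaffians vanish, and its
  trace is a nonzero multiple of \<open>E(z1 w, z2 w)\<close>.

  Conversely, a solution is a rational alternating form \<open>\<alpha>\<close>, of type \<open>(1,1)\<close> by (1), (2), (4), so
  \<open>\<alpha>(x, y) = E(T x, y)\<close> for a complex linear \<open>H\<close>-self-adjoint \<open>T\<close>. By (7)-(9) its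
  characteristic polynomial is \<open>X\<^sup>3 - X\<^sup>2\<close>. Self-adjointness improves \<open>T\<^sup>3 = T\<^sup>2\<close> to \<open>T\<^sup>2 = T\<close>, so \<open>T\<close>
  has rank one, and its image is a line containing the rational vectors \<open>T \<lambda>\<close>, \<open>\<lambda> \<in> \<Lambda>\<close>.
\<close>

section \<open>Lattices and complex tori\<close>

lemma lattice_zero: "0 \<in> \<Lambda>" if "is_lattice \<Lambda>"
proof -
  from that obtain B where "\<Lambda> = range (\<lambda>c :: 'a \<Rightarrow> int. \<Sum>b\<in>B. of_int (c b) *\<^sub>R b)"
    unfolding is_lattice_def lattice_basis_def by blast
  then show ?thesis
    by (auto intro: image_eqI[of _ _ "\<lambda>_. 0"])
qed

lemma lattice_diff: "x - y \<in> \<Lambda>" if "is_lattice \<Lambda>" "x \<in> \<Lambda>" "y \<in> \<Lambda>"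
proof -
  from that(1) obtain B where L: "\<Lambda> = range (\<lambda>c :: 'a \<Rightarrow> int. \<Sum>b\<in>B. of_int (c b) *\<^sub>R b)"
    unfolding is_lattice_def lattice_basis_def by blast
  with that(2,3) obtain c c' :: "'a \<Rightarrow> int"
    where "x = (\<Sum>b\<in>B. of_int (c b) *\<^sub>R b)" "y = (\<Sum>b\<in>B. of_int (c' b) *\<^sub>R b)" by blast
  then have "x - y = (\<Sum>b\<in>B. of_int (c b - c' b) *\<^sub>R b)"
    by (simp add: sum_subtractf scaleR_diff_left)
  then show ?thesis unfolding L by (auto intro: image_eqI[of _ _ "\<lambda>b. c b - c' b"])
qed

lemma lattice_add: "x + y \<in> \<Lambda>" if "is_lattice \<Lambda>" "x \<in> \<Lambda>" "y \<in> \<Lambda>"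
  using lattice_diff[OF that(1,2) lattice_diff[OF that(1) lattice_zero[OF that(1)] that(3)]] by simp

lemma lattice_minus: "- x \<in> \<Lambda>" if "is_lattice \<Lambda>" "x \<in> \<Lambda>"
  using lattice_diff[OF that(1) lattice_zero[OF that(1)] that(2)] by simp

lemma lattice_basis_finite:
  assumes "lattice_basis B \<Lambda>" shows "finite B"
  using assms independent_imp_finite unfolding lattice_basis_def by blast

text \<open>The coordinate functionals of a basis are bounded and take integer values on the
  lattice. A short lattice vector therefore has coordinates of absolute value below 1, so all of
  them vanish.\<close>

lemma lattice_discrete:
  fixes \<Lambda> :: "'v::euclidean_space set"
  assumes "is_lattice \<Lambda>"
  obtains \<epsilon> where "\<epsilon> > 0" "\<And>x. x \<in> \<Lambda> \<Longrightarrow> norm x < \<epsilon> \<Longrightarrow> x = 0"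
proof -
  from assms obtain B where B: "lattice_basis B \<Lambda>" unfolding is_lattice_def by blast
  then have fin: "finite B" by (rule lattice_basis_finite)
  have ind: "independent B" and L: "\<Lambda> = range (\<lambda>c :: 'v \<Rightarrow> int. \<Sum>b\<in>B. of_int (c b) *\<^sub>R b)"
    using B unfolding lattice_basis_def by auto
  have "\<exists>K>0. \<forall>c :: 'v \<Rightarrow> int. \<bar>of_int (c b)\<bar> \<le> K * norm (\<Sum>b\<in>B. of_int (c b) *\<^sub>R b)"
    if b: "b \<in> B" for b
  proof -
    obtain g :: "'v \<Rightarrow> real" where g: "linear g" "\<And>x. x \<in> B \<Longrightarrow> g x = (if x = b then 1 else 0)"
      using linear_independent_extend[OF ind, of "\<lambda>x. if x = b then 1 else 0"] by blast
    interpret g: linear g by (rule g(1))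
    obtain K where K: "K > 0" "\<And>x. \<bar>g x\<bar> \<le> norm x * K"
      using bounded_linear.pos_bounded[OF linear_conv_bounded_linear[THEN iffD1, OF g(1)]] by auto
    have "g (\<Sum>b\<in>B. of_int (c b) *\<^sub>R b) = of_int (c b)" for c :: "'v \<Rightarrow> int"
      using b fin by (simp add: g.sum g.scale g(2) if_distrib[of "\<lambda>x. _ * x"] sum.delta cong: if_cong sum.cong)
    with K show ?thesis by (metis mult.commute)
  qed
  then obtain K where K: "\<And>b. b \<in> B \<Longrightarrow> K b > 0"
    "\<And>b c. b \<in> B \<Longrightarrow> \<bar>of_int (c b)\<bar> \<le> K b * norm (\<Sum>b\<in>B. of_int (c b :: int) *\<^sub>R b)"
    by metis
  define S where "S = 1 + (\<Sum>b\<in>B. K b)"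
  have "(\<Sum>b\<in>B. K b) \<ge> 0" by (rule sum_nonneg) (use K(1) less_imp_le in blast)
  moreover have "K b \<le> (\<Sum>b\<in>B. K b)" if "b \<in> B" for b
    using that K(1) fin by (intro member_le_sum) (auto simp: less_imp_le)
  ultimately have S: "S > 0" "\<And>b. b \<in> B \<Longrightarrow> K b < S"
    unfolding S_def by (simp, fastforce)
  show thesis
  proof
    show "1 / S > 0" using S by simp
    fix x assume "x \<in> \<Lambda>" and n: "norm x < 1 / S"
    then obtain c :: "'v \<Rightarrow> int" where c: "x = (\<Sum>b\<in>B. of_int (c b) *\<^sub>R b)" using L by blast
    have "c b = 0" if "b \<in> B" for b
    proof -
      have "\<bar>of_int (c b)\<bar> \<le> K b * norm x" using K(2)[OF that, of c] c by simp
      also have "\<dots> \<le> S * norm x" using S(2)[OF that] by (simp add: mult_right_mono)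
      also have "\<dots> < 1" using n S(1) by (simp add: field_simps)
      finally show ?thesis by linarith
    qed
    then show "x = 0" unfolding c by simp
  qed
qed

section \<open>The torus as a quotient group of cosets\<close>

lemma comm_group_additive_group: "comm_group (additive_group :: 'v::ab_group_add monoid)"
proof (rule comm_groupI)
  fix x :: 'v
  have "- x + x = 0" by simp
  then show "\<exists>y\<in>carrier additive_group. y \<otimes>\<^bsub>additive_group\<^esub> x = \<one>\<^bsub>additive_group\<^esub>"
    unfolding additive_group_def by (metis monoid.select_convs partial_object.select_convs(1) UNIV_I)
qed (simp_all add: additive_group_def algebra_simps)

lemma subgroup_lattice: "subgroup \<Lambda> additive_group" if "is_lattice \<Lambda>"
proof -
  interpret comm_group "additive_group :: 'a monoid" by (rule comm_group_additive_group)
  have inv: "inv\<^bsub>additive_group\<^esub> x = - x" for x :: 'a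
    by (rule inv_equality) (auto simp: additive_group_def)
  show ?thesis
    by (rule subgroupI)
       (use lattice_zero[OF that] lattice_minus[OF that] lattice_add[OF that] inv in
         \<open>auto simp: additive_group_def\<close>)
qed

lemma torus_proj_altdef: "torus_proj \<Lambda> v = (\<lambda>h. h + v) ` \<Lambda>"
  by (auto simp: torus_proj_def r_coset_def additive_group_def)

lemma torus_proj_eq_iff:
  assumes "is_lattice \<Lambda>"
  shows "torus_proj \<Lambda> x = torus_proj \<Lambda> y \<longleftrightarrow> x - y \<in> \<Lambda>"
proof
  assume "torus_proj \<Lambda> x = torus_proj \<Lambda> y"
  moreover have "x \<in> torus_proj \<Lambda> x"
    using lattice_zero[OF assms] by (force simp: torus_proj_altdef)
  ultimately show "x - y \<in> \<Lambda>" by (auto simp: torus_proj_altdef)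
next
  have sub: "torus_proj \<Lambda> x \<subseteq> torus_proj \<Lambda> y" if "x - y \<in> \<Lambda>" for x y
  proof (unfold torus_proj_altdef, rule image_subsetI)
    fix h assume "h \<in> \<Lambda>"
    from lattice_add[OF assms this that] show "h + x \<in> (\<lambda>h. h + y) ` \<Lambda>"
      by (rule image_eqI[rotated]) (simp add: algebra_simps)
  qed
  assume "x - y \<in> \<Lambda>"
  with lattice_minus[OF assms this] show "torus_proj \<Lambda> x = torus_proj \<Lambda> y"
    by (intro equalityI sub) simp_all
qed

lemma carrier_torus: "carrier (torus \<Lambda>) = range (torus_proj \<Lambda>)"
  by (auto simp: torus_def FactGroup_def RCOSETS_def torus_proj_def additive_group_def)

lemma mult_torus:
  assumes "is_lattice \<Lambda>"
  shows "torus_proj \<Lambda> x \<otimes>\<^bsub>torus \<Lambda>\<^esub> torus_proj \<Lambda> y = torus_proj \<Lambda> (x + y)"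
proof -
  interpret comm_group "additive_group :: 'a monoid" by (rule comm_group_additive_group)
  interpret normal \<Lambda> "additive_group :: 'a monoid"
    by (rule subgroup_imp_normal[OF subgroup_lattice[OF assms]])
  show ?thesis using rcos_sum[of x y]
    by (simp add: torus_def FactGroup_def torus_proj_def additive_group_def)
qed

lemma lattice_basis_subset:
  assumes B: "lattice_basis B \<Lambda>"
  shows "B \<subseteq> \<Lambda>"
proof
  fix b assume b: "b \<in> B"
  have "finite B" using B by (rule lattice_basis_finite)
  have "(\<Sum>x\<in>B. of_int (if x = b then 1 else 0) *\<^sub>R x) = (\<Sum>x\<in>B. if x = b then b else 0)"
    by (rule sum.cong) auto
  then have eq: "b = (\<Sum>x\<in>B. of_int (if x = b then 1 else 0) *\<^sub>R x)"
    using b \<open>finite B\<close> by simp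
  have "b \<in> range (\<lambda>c :: 'a \<Rightarrow> int. \<Sum>x\<in>B. of_int (c x) *\<^sub>R x)"
    by (rule range_eqI[where x = "\<lambda>x. if x = b then 1 else 0"]) (rule eq)
  then show "b \<in> \<Lambda>" using B unfolding lattice_basis_def by blast
qed

text \<open>\<open>Im (cnj u * v)\<close> is the determinant of \<open>u\<close> and
  \<open>v\<close> as vectors of the real plane. Throughout, its being nonzero expresses real linear
  independence.\<close>

lemma lattice_in_complex_independent_pair:
  fixes \<Lambda> :: "complex set"
  assumes "is_lattice \<Lambda>"
  obtains u v where "u \<in> \<Lambda>" "v \<in> \<Lambda>" "Im (cnj u * v) \<noteq> 0"
proof -
  from assms obtain B where B: "lattice_basis B \<Lambda>" unfolding is_lattice_def by blast
  then have fin: "finite B" by (rule lattice_basis_finite)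
  have ind: "independent B" and span: "span B = UNIV"
    using B unfolding lattice_basis_def by auto
  have BL: "B \<subseteq> \<Lambda>" using B by (rule lattice_basis_subset)
  have "B \<noteq> {}"
  proof
    assume "B = {}"
    with span have "(1::complex) \<in> {0}" by simp
    then show False by simp
  qed
  then obtain b where b: "b \<in> B" by blast
  with ind have b0: "b \<noteq> 0" using dependent_zero by blast
  have "\<exists>x\<in>B. Im (cnj b * x) \<noteq> 0"
  proof (rule ccontr)
    assume neg: "\<not> (\<exists>x\<in>B. Im (cnj b * x) \<noteq> 0)"
    have "subspace {x. Im (cnj b * x) = 0}"
      by (rule subspaceI) (auto simp: algebra_simps)
    then have "span B \<subseteq> {x. Im (cnj b * x) = 0}"
      using neg by (intro span_minimal) auto
    \<comment> \<open>The test vector is \<open>b\<close> turned by a right angle: its determinant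
      with \<open>b\<close> is the squared norm of \<open>b\<close>, so it cannot lie on the real
      line of \<open>b\<close>.\<close>
    with span have "\<i> * b \<in> {x. Im (cnj b * x) = 0}" by blast
    then have "Im (cnj b * (\<i> * b)) = 0" by simp
    then have "(Re b)\<^sup>2 + (Im b)\<^sup>2 = 0" by (simp add: power2_eq_square)
    with b0 show False by (simp add: complex_eq_iff sum_power2_eq_zero_iff)
  qed
  with b BL that show thesis by blast
qed

section \<open>Discrete subgroups of the complex plane\<close>

lemma discrete_subgroup_least_norm:
  fixes G :: "complex set"
  assumes diff: "\<And>x y. x \<in> G \<Longrightarrow> y \<in> G \<Longrightarrow> x - y \<in> G"
    and e: "\<epsilon> > 0" "\<And>x. x \<in> G \<Longrightarrow> norm x < \<epsilon> \<Longrightarrow> x = 0"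
    and x0: "x0 \<in> G" "P x0"
  obtains x where "x \<in> G" "P x" "\<And>y. y \<in> G \<Longrightarrow> P y \<Longrightarrow> norm x \<le> norm y"
proof -
  \<comment> \<open>Cutting off at the norm of \<open>x0\<close> leaves a bounded, uniformly
    discrete and hence finite set, on which the norm attains its minimum.\<close>
  define S where "S = {x \<in> G. P x \<and> norm x \<le> norm x0}"
  have "uniform_discrete S"
  proof (rule uniformI1[OF e(1)])
    fix x y assume "x \<in> S" "y \<in> S" "dist x y < \<epsilon>"
    with e(2)[of "x - y"] diff show "x = y" by (auto simp: S_def dist_norm)
  qed
  moreover have "bounded S" unfolding bounded_iff S_def by blast
  ultimately have fin: "finite S" using uniform_discrete_finite_iff by blast
  have ne: "S \<noteq> {}" using x0 by (auto simp: S_def)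
  define x where "x = arg_min_on norm S"
  have "x \<in> S" and m: "\<And>y. y \<in> S \<Longrightarrow> norm x \<le> norm y"
    using arg_min_if_finite[OF fin ne, of norm] unfolding x_def by (auto simp: not_less)
  moreover have "norm x \<le> norm y" if "y \<in> G" "P y" for y
    using m[of y] that \<open>x \<in> S\<close> by (cases "norm y \<le> norm x0") (auto simp: S_def)
  ultimately show thesis using that[of x] by (auto simp: S_def)
qed

lemma complex_cramer:
  fixes a b x :: complex
  assumes "Im (cnj a * b) \<noteq> 0"
  shows "x = (Im (cnj x * b) / Im (cnj a * b)) *\<^sub>R a + (Im (cnj a * x) / Im (cnj a * b)) *\<^sub>R b"
proof -
  have "Im (cnj a * b) *\<^sub>R x = Im (cnj x * b) *\<^sub>R a + Im (cnj a * x) *\<^sub>R b"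
    by (simp add: complex_eq_iff algebra_simps)
  then have "x = (1 / Im (cnj a * b)) *\<^sub>R (Im (cnj x * b) *\<^sub>R a + Im (cnj a * x) *\<^sub>R b)"
    using assms by (metis divide_inverse mult_1 scaleR_one scaleR_scaleR left_inverse)
  then show ?thesis by (simp add: scaleR_add_right)
qed

text \<open>A reduced basis: \<open>a\<close> is a shortest nonzero vector, and \<open>b\<close> a shortest one off the line of \<open>a\<close>.\<close>

lemma discrete_subgroup_complex_is_lattice:
  fixes G :: "complex set"
  assumes diff: "\<And>x y. x \<in> G \<Longrightarrow> y \<in> G \<Longrightarrow> x - y \<in> G"
    and e: "\<epsilon> > 0" "\<And>x. x \<in> G \<Longrightarrow> norm x < \<epsilon> \<Longrightarrow> x = 0"
    and uv: "u \<in> G" "v \<in> G" "Im (cnj u * v) \<noteq> 0"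
  shows "is_lattice G"
proof -
  have zero: "0 \<in> G" using diff[OF uv(1,1)] by simp
  have minus: "- x \<in> G" if "x \<in> G" for x using diff[OF zero that] by simp
  have add: "x + y \<in> G" if "x \<in> G" "y \<in> G" for x y using diff[OF that(1) minus[OF that(2)]] by simp
  have nat_mult: "of_nat n *\<^sub>R x \<in> G" if "x \<in> G" for n :: nat and x
    by (induction n) (use that zero add in \<open>auto simp: algebra_simps\<close>)
  have int_mult: "of_int n *\<^sub>R x \<in> G" if "x \<in> G" for n :: int and x
    using nat_mult[OF that, of "nat n"] minus[OF nat_mult[OF that, of "nat (- n)"]]
    by (cases "n \<ge> 0") auto
  have "u \<noteq> 0" using uv by auto
  with uv(1) obtain a where a: "a \<in> G" "a \<noteq> 0" "\<And>y. y \<in> G \<Longrightarrow> y \<noteq> 0 \<Longrightarrow> norm a \<le> norm y"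
    using discrete_subgroup_least_norm[OF diff e, of u "\<lambda>x. x \<noteq> 0"] by blast
  have "Im (cnj a * u) \<noteq> 0 \<or> Im (cnj a * v) \<noteq> 0"
  proof (rule ccontr)
    assume "\<not> ?thesis"
    \<comment> \<open>Otherwise \<open>u\<close> and \<open>v\<close> are both real multiples of
      \<open>a\<close>, which makes \<open>cnj u * v\<close> real.\<close>
    then have "u * cnj a = of_real (Re (u * cnj a))" "v * cnj a = of_real (Re (v * cnj a))"
      by (auto simp: complex_eq_iff algebra_simps)
    then have "cnj (u * cnj a) * (v * cnj a) = of_real (Re (u * cnj a) * Re (v * cnj a))"
      by (metis complex_cnj_complex_of_real of_real_mult)
    moreover have "cnj (u * cnj a) * (v * cnj a) = of_real ((norm a)\<^sup>2) * (cnj u * v)"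
      by (subst complex_norm_square) (simp add: algebra_simps)
    ultimately have "Im (of_real ((norm a)\<^sup>2) * (cnj u * v)) = 0" by (metis Im_complex_of_real)
    with uv(3) a(2) show False by (simp del: of_real_power)
  qed
  with uv(1,2) obtain x0 where "x0 \<in> G" "Im (cnj a * x0) \<noteq> 0" by blast
  then obtain b where b: "b \<in> G" "Im (cnj a * b) \<noteq> 0"
      "\<And>y. y \<in> G \<Longrightarrow> Im (cnj a * y) \<noteq> 0 \<Longrightarrow> norm b \<le> norm y"
    using discrete_subgroup_least_norm[OF diff e, of x0 "\<lambda>x. Im (cnj a * x) \<noteq> 0"] by blast
  define D where "D = Im (cnj a * b)"
  have D: "D \<noteq> 0" using b(2) by (simp add: D_def)
  have "b \<noteq> 0" "a \<noteq> b" using b(2) by auto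
  have ab: "norm a \<le> norm b" using a(3)[OF b(1) \<open>b \<noteq> 0\<close>] .
  have span: "span {a, b} = UNIV"
  proof -
    have "x \<in> span {a, b}" for x
      by (subst complex_cramer[OF b(2)]) (intro span_add span_scale span_base; simp)
    then show ?thesis by blast
  qed
  have "independent {a, b}"
    by (rule card_le_dim_spanning[of _ UNIV]) (use \<open>a \<noteq> b\<close> in \<open>auto simp: span\<close>)
  moreover have "G = range (\<lambda>c :: complex \<Rightarrow> int. \<Sum>x\<in>{a, b}. of_int (c x) *\<^sub>R x)"
  proof (intro equalityI subsetI)
    fix x assume "x \<in> range (\<lambda>c :: complex \<Rightarrow> int. \<Sum>x\<in>{a, b}. of_int (c x) *\<^sub>R x)"
    then show "x \<in> G" using \<open>a \<noteq> b\<close> add int_mult a(1) b(1) by auto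
  next
    fix x assume "x \<in> G"
    obtain s t where x: "x = s *\<^sub>R a + t *\<^sub>R b" using complex_cramer[OF b(2)] by blast
    \<comment> \<open>Rounding to nearest integers leaves a remainder \<open>y\<close> in
      \<open>G\<close> whose coefficients are at most 1/2 in absolute value.\<close>
    define s' t' where "s' = s - of_int (round s)" and "t' = t - of_int (round t)"
    have le: "\<bar>s'\<bar> \<le> 1/2" "\<bar>t'\<bar> \<le> 1/2"
      using of_int_round_abs_le[of s] of_int_round_abs_le[of t] by (auto simp: s'_def t'_def abs_minus_commute)
    define y where "y = s' *\<^sub>R a + t' *\<^sub>R b"
    have "y = x - (of_int (round s) *\<^sub>R a + of_int (round t) *\<^sub>R b)"
      unfolding y_def x s'_def t'_def by (simp add: algebra_simps)
    then have "y \<in> G" using \<open>x \<in> G\<close> diff add int_mult a(1) b(1) by auto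
    have le': "norm (s' *\<^sub>R a) \<le> norm a / 2" "norm (t' *\<^sub>R b) \<le> norm b / 2"
      using mult_right_mono[OF le(1), of "norm a"] mult_right_mono[OF le(2), of "norm b"] by auto
    have im: "Im (cnj a * (r *\<^sub>R a)) = 0" "Im (cnj a * (r *\<^sub>R b)) = r * D" for r
      unfolding D_def by (simp_all add: algebra_simps)
    \<comment> \<open>If \<open>y\<close> were off the line of \<open>a\<close>, then |b| \<le> |y|
      \<le> |a|/2 + |b|/2 \<le> |b|. Equality in the triangle inequality makes the two summands
      parallel, which forces the \<open>a\<close> part to vanish and leaves |y| \<le> |b|/2, a
      contradiction.\<close>
    have "t' = 0"
    proof (rule ccontr)
      assume t': "t' \<noteq> 0"
      have "Im (cnj a * y) = t' * D" unfolding y_def distrib_left using im[of s'] im[of t'] by simp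
      then have big: "norm b \<le> norm y" using b(3)[OF \<open>y \<in> G\<close>] t' D by simp
      then have "norm (s' *\<^sub>R a + t' *\<^sub>R b) = norm (s' *\<^sub>R a) + norm (t' *\<^sub>R b)"
        using norm_triangle_ineq[of "s' *\<^sub>R a" "t' *\<^sub>R b"] le' ab unfolding y_def by linarith
      then have "norm (s' *\<^sub>R a) *\<^sub>R (t' *\<^sub>R b) = norm (t' *\<^sub>R b) *\<^sub>R (s' *\<^sub>R a)"
        by (simp only: norm_triangle_eq)
      then have "Im (cnj a * ((norm (s' *\<^sub>R a) * t') *\<^sub>R b)) = Im (cnj a * ((norm (t' *\<^sub>R b) * s') *\<^sub>R a))"
        by simp
      then have "s' *\<^sub>R a = 0" unfolding im using t' D by auto
      then have "y = t' *\<^sub>R b" by (simp add: y_def)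
      then have "norm y \<le> norm b / 2" using le'(2) by simp
      moreover have "norm b > 0" using \<open>b \<noteq> 0\<close> by simp
      ultimately show False using big by linarith
    qed
    \<comment> \<open>Now \<open>y\<close> lies on the line of \<open>a\<close> with at most half
      its norm, so the minimality of \<open>a\<close> gives \<open>y = 0\<close>.\<close>
    then have "norm y \<le> norm a / 2" using le'(1) by (simp add: y_def)
    moreover have "norm a > 0" using a(2) by simp
    ultimately have "\<not> norm a \<le> norm y" by linarith
    with a(3)[OF \<open>y \<in> G\<close>] have "y = 0" by blast
    with \<open>t' = 0\<close> a(2) have "s' = 0" by (simp add: y_def)
    with \<open>t' = 0\<close> have "x = of_int (round s) *\<^sub>R a + of_int (round t) *\<^sub>R b"
      unfolding x s'_def t'_def by simp
    then show "x \<in> range (\<lambda>c :: complex \<Rightarrow> int. \<Sum>x\<in>{a, b}. of_int (c x) *\<^sub>R x)"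
      using \<open>a \<noteq> b\<close> by (intro image_eqI[of _ _ "\<lambda>z. if z = a then round s else round t"]) auto
  qed
  ultimately show ?thesis unfolding is_lattice_def lattice_basis_def using span by blast
qed

text \<open>A local lift of \<open>\<phi>\<close> at 0, translated to vanish there, is additive
  modulo \<open>\<Lambda>\<close>, hence additive near 0 by discreteness. Being holomorphic as well,
  it is multiplication by a vector \<open>c\<close>. The homomorphism property spreads this formula
  to the whole plane, injectivity gives \<open>c \<noteq> 0\<close>, and \<open>\<Lambda>'\<close>
  is carried into \<open>\<Lambda>\<close>.\<close>

lemma elliptic_curve_imp_line:
  fixes \<Lambda> :: "(complex ^ 'n) set"
  assumes L: "is_lattice \<Lambda>" and E: "elliptic_curve_in \<Lambda> E"
  obtains w z1 z2 where "w \<noteq> 0" "Im (cnj z1 * z2) \<noteq> 0" "z1 *s w \<in> \<Lambda>" "z2 *s w \<in> \<Lambda>"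
proof -
  from E obtain \<Lambda>' \<phi> where L': "is_lattice \<Lambda>'" and hom: "\<phi> \<in> hom (torus \<Lambda>') (torus \<Lambda>)"
    and inj: "inj_on \<phi> (carrier (torus \<Lambda>'))" and hol: "holomorphic_torus_map \<Lambda>' \<Lambda> \<phi>"
    unfolding elliptic_curve_in_def by blast
  obtain \<epsilon> where \<epsilon>: "\<epsilon> > 0" "\<And>x. x \<in> \<Lambda> \<Longrightarrow> norm x < \<epsilon> \<Longrightarrow> x = 0"
    using lattice_discrete[OF L] by blast
  obtain \<epsilon>' where \<epsilon>': "\<epsilon>' > 0" "\<And>x. x \<in> \<Lambda>' \<Longrightarrow> norm x < \<epsilon>' \<Longrightarrow> x = 0"
    using lattice_discrete[OF L'] by blast
  have hom': "\<phi> (torus_proj \<Lambda>' (x + y)) = torus_proj \<Lambda> (a + b)"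
    if "\<phi> (torus_proj \<Lambda>' x) = torus_proj \<Lambda> a" "\<phi> (torus_proj \<Lambda>' y) = torus_proj \<Lambda> b" for x y a b
    using hom_mult[OF hom, of "torus_proj \<Lambda>' x" "torus_proj \<Lambda>' y"] that
    by (simp add: mult_torus L L' carrier_torus)
  from hol obtain U g where U: "open U" "0 \<in> U" and gh: "\<And>i. (\<lambda>z. g z $ i) holomorphic_on U"
    and g: "\<And>z. z \<in> U \<Longrightarrow> \<phi> (torus_proj \<Lambda>' z) = torus_proj \<Lambda> (g z)"
    unfolding holomorphic_torus_map_def by metis
  \<comment> \<open>Apply the homomorphism property to 0 + 0 = 0.\<close>
  have g0: "g 0 \<in> \<Lambda>"
    using hom'[OF g[OF U(2)] g[OF U(2)]] g[OF U(2)] torus_proj_eq_iff[OF L, of "g 0 + g 0" "g 0"] by simp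
  define h where "h z = g z - g 0" for z
  have h0: "h 0 = 0" by (simp add: h_def)
  have add_mod: "h (x + y) - (h x + h y) \<in> \<Lambda>" if "x \<in> U" "y \<in> U" "x + y \<in> U" for x y
  proof -
    have "g (x + y) - (g x + g y) \<in> \<Lambda>"
      using hom'[OF g[OF that(1)] g[OF that(2)]] g[OF that(3)] by (simp flip: torus_proj_eq_iff[OF L])
    from lattice_add[OF L this g0] show ?thesis by (simp add: h_def algebra_simps)
  qed
  have "continuous_on U (\<lambda>z. \<chi> i. g z $ i)"
    by (intro continuous_on_vec_lambda holomorphic_on_imp_continuous_on gh)
  then have "isCont g 0" using U by (simp add: continuous_on_eq_continuous_at)
  then have "isCont h 0" unfolding h_def by (intro continuous_intros)
  then obtain \<delta>1 where "\<delta>1 > 0" and \<delta>1: "\<And>x. norm x < \<delta>1 \<Longrightarrow> norm (h x) < \<epsilon> / 3"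
    using \<epsilon>(1) unfolding continuous_at_eps_delta h0
    by (metis diff_zero dist_norm zero_less_divide_iff zero_less_numeral)
  obtain \<delta>2 where "\<delta>2 > 0" "ball 0 \<delta>2 \<subseteq> U" using U openE by blast
  define \<delta> where "\<delta> = min \<delta>1 \<delta>2"
  have \<delta>: "\<delta> > 0" "\<And>x. norm x < \<delta> \<Longrightarrow> x \<in> U" "\<And>x. norm x < \<delta> \<Longrightarrow> norm (h x) < \<epsilon> / 3"
    using \<open>\<delta>1 > 0\<close> \<open>\<delta>2 > 0\<close> \<open>ball 0 \<delta>2 \<subseteq> U\<close> \<delta>1 by (auto simp: \<delta>_def)
  have h_add: "h (x + y) = h x + h y" if "norm x < \<delta>" "norm y < \<delta>" "norm (x + y) < \<delta>" for x y
  proof -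
    \<comment> \<open>The defect of additivity lies in \<open>\<Lambda>\<close>; three terms of norm
      below \<epsilon>/3 keep it under the discreteness bound.\<close>
    have "norm (h (x + y) - (h x + h y)) < \<epsilon>"
      using \<delta>(3)[OF that(1)] \<delta>(3)[OF that(2)] \<delta>(3)[OF that(3)]
        norm_triangle_ineq4[of "h (x + y)" "h x + h y"] norm_triangle_ineq[of "h x" "h y"] by linarith
    with \<epsilon>(2)[OF add_mod] \<delta>(2) that show ?thesis by simp
  qed
  have h_mult: "h (of_nat k * x) = of_nat k *\<^sub>R h x" if "of_nat k * norm x < \<delta>" for k and x
    using that
  proof (induction k)
    case 0
    then show ?case using h0 by simp
  next
    case (Suc k)
    show ?case
    proof (cases "k = 0")
      case False
      then have "norm x \<le> of_nat k * norm x" by (simp add: mult_le_cancel_right1)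
      then have "norm x < \<delta>" "of_nat k * norm x < \<delta>" using Suc.prems norm_ge_zero[of x]
        by (simp_all add: algebra_simps del: norm_ge_zero)
      moreover have "norm (of_nat k * x + x) < \<delta>"
        using Suc.prems norm_triangle_ineq[of "of_nat k * x" x] by (simp add: norm_mult algebra_simps)
      ultimately show ?thesis
        using Suc.IH h_add[of "of_nat k * x" x] by (simp add: norm_mult algebra_simps)
    qed simp
  qed
  define c where "c = (\<chi> i. deriv (\<lambda>z. g z $ i) 0)"
  have h_lin: "h z = z *s c" if z: "norm z < \<delta>" for z
  proof (cases "z = 0")
    case False
    have "h z $ i = z * c $ i" for i
    proof -
      have "((\<lambda>z. g z $ i) has_field_derivative c $ i) (at 0)"
        using holomorphic_derivI[OF gh U(1) U(2)] unfolding c_def by simp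
      then have lim: "((\<lambda>t. h t $ i / t) \<longlongrightarrow> c $ i) (at 0)"
        by (simp add: has_field_derivative_iff h_def)
      \<comment> \<open>Along this sequence the difference quotient is constant by
        \<open>h_mult\<close>, yet it tends to the derivative at 0.\<close>
      have "(\<lambda>n. z / of_nat (Suc n)) \<longlonglongrightarrow> 0"
        by (rule LIMSEQ_Suc) (rule lim_const_over_n)
      then have "filterlim (\<lambda>n. z / of_nat (Suc n)) (at 0) sequentially"
        using False by (simp add: filterlim_at del: of_nat_Suc)
      from filterlim_compose[OF lim this]
      have "(\<lambda>n. h (z / of_nat (Suc n)) $ i / (z / of_nat (Suc n))) \<longlonglongrightarrow> c $ i" .
      moreover have eq: "h (z / of_nat (Suc n)) $ i / (z / of_nat (Suc n)) = h z $ i / z" for n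
        using h_mult[of "Suc n" "z / of_nat (Suc n)"] z False
        by (simp add: norm_divide scaleR_conv_of_real[where 'a = complex] field_simps del: of_nat_Suc)
      ultimately have "c $ i = h z $ i / z" unfolding eq LIMSEQ_const_iff by simp
      with False show ?thesis by simp
    qed
    then show ?thesis by (simp add: vec_eq_iff)
  qed (simp add: h0)
  have \<phi>_small: "\<phi> (torus_proj \<Lambda>' z) = torus_proj \<Lambda> (z *s c)" if "norm z < \<delta>" for z
  proof -
    have "torus_proj \<Lambda> (g z) = torus_proj \<Lambda> (z *s c)"
      unfolding torus_proj_eq_iff[OF L] using h_lin[OF that] g0 by (simp add: h_def diff_eq_eq)
    with g \<delta>(2) that show ?thesis by simp
  qed
  \<comment> \<open>An arbitrary \<open>z\<close> is an integer multiple of a point \<open>x\<close>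
    of the small disc.\<close>
  have \<phi>: "\<phi> (torus_proj \<Lambda>' z) = torus_proj \<Lambda> (z *s c)" for z
  proof -
    obtain n where n: "norm z / \<delta> < of_nat n" using reals_Archimedean2 by blast
    then have "n > 0" using \<delta>(1) by (cases "n = 0") (auto simp: field_simps)
    define x where "x = z / of_nat n"
    have x: "norm x < \<delta>" using n \<open>n > 0\<close> \<delta>(1) by (simp add: x_def norm_divide field_simps)
    have "\<phi> (torus_proj \<Lambda>' (of_nat k * x)) = torus_proj \<Lambda> ((of_nat k * x) *s c)" for k
    proof (induction k)
      case 0
      then show ?case using \<phi>_small[of 0] \<delta>(1) by simp
    next
      case (Suc k)
      from hom'[OF Suc \<phi>_small[OF x]] show ?case by (simp add: algebra_simps vec.scale_left_distrib)
    qed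
    from this[of n] \<open>n > 0\<close> show ?thesis by (simp add: x_def)
  qed
  have "c \<noteq> 0"
  proof
    assume "c = 0"
    \<comment> \<open>For \<open>c = 0\<close> injectivity would put this \<open>z\<close> into
      \<open>\<Lambda>'\<close>, although it is nonzero and below the discreteness bound.\<close>
    define z where "z = complex_of_real (\<epsilon>' / 2)"
    have "\<phi> (torus_proj \<Lambda>' z) = \<phi> (torus_proj \<Lambda>' 0)" using \<phi>[of z] \<phi>[of 0] \<open>c = 0\<close> by simp
    with inj have "torus_proj \<Lambda>' z = torus_proj \<Lambda>' 0" by (auto simp: inj_on_def carrier_torus)
    then have "z \<in> \<Lambda>'" by (simp add: torus_proj_eq_iff[OF L'])
    with \<epsilon>'(2)[of z] \<epsilon>'(1) show False by (simp add: z_def)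
  qed
  moreover have "z *s c \<in> \<Lambda>" if "z \<in> \<Lambda>'" for z
  proof -
    have "torus_proj \<Lambda>' z = torus_proj \<Lambda>' 0" using that by (simp add: torus_proj_eq_iff[OF L'])
    then have "torus_proj \<Lambda> (z *s c) = torus_proj \<Lambda> 0" using \<phi>[of z] \<phi>[of 0] by simp
    then show ?thesis by (simp add: torus_proj_eq_iff[OF L])
  qed
  ultimately show thesis using lattice_in_complex_independent_pair[OF L'] that by metis
qed

text \<open>The scalars \<open>z\<close> with \<open>z *s w\<close> in \<open>\<Lambda>\<close> form
  a discrete subgroup containing the independent pair \<open>z1\<close>, \<open>z2\<close>, hence a
  lattice. It is the kernel of the induced map to the torus, so dividing by it gives
  injectivity.\<close>

lemma line_imp_elliptic_curve:
  fixes \<Lambda> :: "(complex ^ 'n) set"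
  assumes L: "is_lattice \<Lambda>" and w: "w \<noteq> 0"
    and z: "Im (cnj z1 * z2) \<noteq> 0" "z1 *s w \<in> \<Lambda>" "z2 *s w \<in> \<Lambda>"
  shows "\<exists>E. elliptic_curve_in \<Lambda> E"
proof -
  obtain \<epsilon> where \<epsilon>: "\<epsilon> > 0" "\<And>x. x \<in> \<Lambda> \<Longrightarrow> norm x < \<epsilon> \<Longrightarrow> x = 0"
    using lattice_discrete[OF L] by blast
  define \<Lambda>' where "\<Lambda>' = {z. z *s w \<in> \<Lambda>}"
  have nw: "norm (z *s w) = norm z * norm w" for z
    by (simp add: norm_vec_def norm_mult L2_set_right_distrib)
  have L': "is_lattice \<Lambda>'"
  proof (rule discrete_subgroup_complex_is_lattice[of _ "\<epsilon> / norm w" z1 z2])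
    show "\<epsilon> / norm w > 0" using \<epsilon>(1) w by simp
    show "x - y \<in> \<Lambda>'" if "x \<in> \<Lambda>'" "y \<in> \<Lambda>'" for x y
      using that lattice_diff[OF L] by (auto simp: \<Lambda>'_def vec.scale_left_diff_distrib)
    show "x = 0" if "x \<in> \<Lambda>'" "norm x < \<epsilon> / norm w" for x
      using \<epsilon>(2)[of "x *s w"] that w by (auto simp: \<Lambda>'_def nw field_simps)
  qed (use z in \<open>auto simp: \<Lambda>'_def\<close>)
  \<comment> \<open>The map is defined through a chosen representative; \<open>iff\<close> shows
    both that the choice is immaterial and that the map is injective.\<close>
  define \<phi> where "\<phi> X = torus_proj \<Lambda> ((SOME z. torus_proj \<Lambda>' z = X) *s w)" for X
  have iff: "torus_proj \<Lambda> (x *s w) = torus_proj \<Lambda> (y *s w) \<longleftrightarrow> torus_proj \<Lambda>' x = torus_proj \<Lambda>' y" for x y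
    unfolding torus_proj_eq_iff[OF L] torus_proj_eq_iff[OF L']
    by (simp add: \<Lambda>'_def vec.scale_left_diff_distrib)
  have \<phi>: "\<phi> (torus_proj \<Lambda>' z) = torus_proj \<Lambda> (z *s w)" for z
    unfolding \<phi>_def iff by (rule someI_ex) blast
  have "\<phi> \<in> hom (torus \<Lambda>') (torus \<Lambda>)"
    by (rule homI) (auto simp: carrier_torus \<phi> mult_torus L L' vec.scale_left_distrib)
  moreover have "inj_on \<phi> (carrier (torus \<Lambda>'))"
    by (auto simp: inj_on_def carrier_torus \<phi> iff)
  moreover have "holomorphic_torus_map \<Lambda>' \<Lambda> \<phi>"
    unfolding holomorphic_torus_map_def
    by (intro allI exI[of _ UNIV] exI[of _ "\<lambda>z. z *s w"]) (auto simp: \<phi> intro!: holomorphic_intros)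
  ultimately show ?thesis unfolding elliptic_curve_in_def using L' by blast
qed

section \<open>Symplectic coordinates\<close>

lemma scaleR_eq_vec_scale: "r *\<^sub>R x = complex_of_real r *s x" for x :: "complex ^ 'n"
  by (simp add: vec_eq_iff scaleR_conv_of_real[where 'a = complex])

locale period_basis =
  fixes \<Lambda> :: "(complex ^ 'n) set" and H :: "complex ^ 'n \<Rightarrow> complex ^ 'n \<Rightarrow> complex"
    and d :: "nat ^ 'n" and Z :: "complex ^ 'n ^ 'n" and e :: "'n \<Rightarrow> complex ^ 'n"
  assumes lattice: "is_lattice \<Lambda>" and polarization: "polarization \<Lambda> H"
    and d_pos: "\<And>i. 0 < d $ i" and Z_sym: "transpose Z = Z"
    and e_inj: "inj e" and e_indep: "vec.independent (range e)" and e_span: "vec.span (range e) = UNIV"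
    and symplectic: "symplectic_basis \<Lambda> H d
      (\<lambda>j. \<Sum>i\<in>UNIV. diag_matrix d $ i $ j *s e i) (\<lambda>j. \<Sum>i\<in>UNIV. Z $ i $ j *s e i)"
begin

definition l :: "'n \<Rightarrow> complex ^ 'n" where "l j = of_nat (d $ j) *s e j"
definition m :: "'n \<Rightarrow> complex ^ 'n" where "m j = (\<Sum>i\<in>UNIV. Z $ i $ j *s e i)"

lemma symplectic_l_m: "symplectic_basis \<Lambda> H d l m"
proof -
  have "(\<Sum>i\<in>UNIV. diag_matrix d $ i $ j *s e i) = l j" for j
  proof -
    have "(\<Sum>i\<in>UNIV. diag_matrix d $ i $ j *s e i) = (\<Sum>i\<in>UNIV. if i = j then l j else 0)"
      by (rule sum.cong) (auto simp: diag_matrix_def l_def)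
    then show ?thesis by simp
  qed
  with symplectic show ?thesis unfolding m_def by simp
qed

lemma Z_swap: "Z $ i $ j = Z $ j $ i"
  using arg_cong[OF Z_sym, of "\<lambda>A. A $ i $ j"] by (simp add: transpose_def)

lemma H_add_left: "H (x + y) z = H x z + H y z"
  and H_scale_left: "H (c *s x) y = c * H x y"
  and H_cnj: "H y x = cnj (H x y)"
  using polarization unfolding polarization_def hermitian_form_def by blast+

lemma H_pos: "x \<noteq> 0 \<Longrightarrow> 0 < Re (H x x)"
  and H_integral: "x \<in> \<Lambda> \<Longrightarrow> y \<in> \<Lambda> \<Longrightarrow> Im (H x y) \<in> \<int>"
  using polarization unfolding polarization_def by blast+

lemma H_add_right: "H x (y + z) = H x y + H x z"
  using H_cnj[of x "y + z"] H_cnj[of x y] H_cnj[of x z] by (simp add: H_add_left)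

lemma H_scale_right: "H x (c *s y) = cnj c * H x y"
  using H_cnj[of x "c *s y"] H_cnj[of x y] by (simp add: H_scale_left)

lemma H_scaleR_left: "H (r *\<^sub>R x) y = of_real r * H x y"
  and H_scaleR_right: "H x (r *\<^sub>R y) = of_real r * H x y"
  by (simp_all add: scaleR_eq_vec_scale H_scale_left H_scale_right)

lemma H_zero_left: "H 0 y = 0" and H_zero_right: "H x 0 = 0"
  using H_scaleR_left[of 0] H_scaleR_right[of _ 0] by auto

lemma H_diff_left: "H (x - y) z = H x z - H y z"
  using H_add_left[of "x - y" y z] by simp

lemma H_diff_right: "H x (y - z) = H x y - H x z"
  using H_add_right[of x "y - z" z] by simp

lemma H_sum_left: "H (sum f A) y = (\<Sum>i\<in>A. H (f i) y)"
  by (induction A rule: infinite_finite_induct) (simp_all add: H_zero_left H_add_left)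

lemma H_sum_right: "H x (sum f A) = (\<Sum>i\<in>A. H x (f i))"
  by (induction A rule: infinite_finite_induct) (simp_all add: H_zero_right H_add_right)

abbreviation E :: "complex ^ 'n \<Rightarrow> complex ^ 'n \<Rightarrow> real" where "E x y \<equiv> Im (H x y)"

lemma E_swap: "E x y = - E y x"
  using H_cnj[of x y] by simp

lemma E_l_l: "E (l i) (l j) = 0" and E_m_m: "E (m i) (m j) = 0"
  and E_m_l: "E (m i) (l j) = (if i = j then real (d $ i) else 0)"
  using symplectic_l_m unfolding symplectic_basis_def by auto

lemma E_l_m: "E (l i) (m j) = (if i = j then - real (d $ i) else 0)"
  using E_swap[of "l i" "m j"] by (simp add: E_m_l)

lemma lattice_basis_l_m: "lattice_basis (range (case_sum l m)) \<Lambda>"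
  using symplectic_l_m unfolding symplectic_basis_def by blast

lemma l_in_lattice: "l i \<in> \<Lambda>" and m_in_lattice: "m i \<in> \<Lambda>"
proof -
  have "case_sum l m s \<in> \<Lambda>" for s
    using lattice_basis_subset[OF lattice_basis_l_m] by blast
  from this[of "Inl i"] this[of "Inr i"] show "l i \<in> \<Lambda>" "m i \<in> \<Lambda>" by simp_all
qed

text \<open>This reduces real linear statements to the lattice basis; \<open>complex_span_e\<close>
  is its complex linear counterpart.\<close>

lemma real_span_l_m:
  assumes "subspace S" "\<And>i. l i \<in> S" "\<And>i. m i \<in> S"
  shows "x \<in> S"
proof -
  have "range (case_sum l m) \<subseteq> S"
    using assms(2,3) by (auto split: sum.split)
  then have "span (range (case_sum l m)) \<subseteq> S" using assms(1) by (rule span_minimal)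
  then show ?thesis using lattice_basis_l_m unfolding lattice_basis_def by blast
qed

lemma lattice_coordinates:
  assumes "x \<in> \<Lambda>"
  obtains p q :: "'n \<Rightarrow> int"
  where "x = (\<Sum>i\<in>UNIV. of_int (p i) *\<^sub>R l i) + (\<Sum>i\<in>UNIV. of_int (q i) *\<^sub>R m i)"
proof -
  from assms lattice_basis_l_m obtain c :: "complex ^ 'n \<Rightarrow> int"
    where "x = (\<Sum>b\<in>range (case_sum l m). of_int (c b) *\<^sub>R b)"
    unfolding lattice_basis_def by blast
  also have "\<dots> = (\<Sum>s\<in>UNIV. of_int (c (case_sum l m s)) *\<^sub>R case_sum l m s)"
    using symplectic_l_m unfolding symplectic_basis_def by (simp add: sum.reindex)
  also have "\<dots> = (\<Sum>i\<in>UNIV. of_int (c (l i)) *\<^sub>R l i) + (\<Sum>i\<in>UNIV. of_int (c (m i)) *\<^sub>R m i)"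
    by (simp flip: UNIV_Plus_UNIV add: sum.Plus)
  finally show thesis by (rule that)
qed

text \<open>By the symplectic relations \<open>l k\<close> pairs only with \<open>m k\<close>, so
  \<open>E\<close> reads off a single coordinate. The minus sign comes from the orientation
  \<open>E (m k) (l k) = d k\<close>.\<close>

lemma E_l_coordinates:
  "E (l k) ((\<Sum>i\<in>UNIV. p i *\<^sub>R l i) + (\<Sum>i\<in>UNIV. q i *\<^sub>R m i)) = - real (d $ k) * q k"
proof -
  have "(\<Sum>i\<in>UNIV. q i * E (l k) (m i)) = (\<Sum>i\<in>UNIV. if i = k then - real (d $ k) * q k else 0)"
    by (rule sum.cong) (auto simp: E_l_m)
  then show ?thesis
    by (simp add: H_add_right H_sum_right H_scaleR_right E_l_l)
qed

lemma E_m_coordinates: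
  "E (m k) ((\<Sum>i\<in>UNIV. p i *\<^sub>R l i) + (\<Sum>i\<in>UNIV. q i *\<^sub>R m i)) = real (d $ k) * p k"
proof -
  have "(\<Sum>i\<in>UNIV. p i * E (m k) (l i)) = (\<Sum>i\<in>UNIV. if i = k then real (d $ k) * p k else 0)"
    by (rule sum.cong) (auto simp: E_m_l)
  then show ?thesis
    by (simp add: H_add_right H_sum_right H_scaleR_right E_m_m)
qed

text \<open>The left side is the trace of the form \<open>E(., x) \<and> E(., y)\<close> that
  equation (7) normalizes to -1.\<close>

lemma E_symplectic_expansion:
  assumes "x \<in> \<Lambda>" "y \<in> \<Lambda>"
  shows "(\<Sum>k\<in>UNIV. (E (l k) x * E (m k) y - E (m k) x * E (l k) y) / d $ k) = - E x y"
proof -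
  obtain p q where x: "x = (\<Sum>i\<in>UNIV. of_int (p i) *\<^sub>R l i) + (\<Sum>i\<in>UNIV. of_int (q i) *\<^sub>R m i)"
    using lattice_coordinates[OF assms(1)] .
  obtain p' q' where y: "y = (\<Sum>i\<in>UNIV. of_int (p' i) *\<^sub>R l i) + (\<Sum>i\<in>UNIV. of_int (q' i) *\<^sub>R m i)"
    using lattice_coordinates[OF assms(2)] .
  have E: "E (l k) x = - real (d $ k) * q k" "E (m k) x = real (d $ k) * p k"
    "E (l k) y = - real (d $ k) * q' k" "E (m k) y = real (d $ k) * p' k" for k
    unfolding x y by (simp_all only: E_l_coordinates E_m_coordinates)
  have "E x y = (\<Sum>k\<in>UNIV. p k * E (l k) y) + (\<Sum>k\<in>UNIV. q k * E (m k) y)"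
    by (subst x) (simp add: H_add_left H_sum_left H_scaleR_left)
  also have "\<dots> = (\<Sum>k\<in>UNIV. p k * E (l k) y + q k * E (m k) y)"
    by (simp only: sum.distrib)
  also have "\<dots> = (\<Sum>k\<in>UNIV. - ((E (l k) x * E (m k) y - E (m k) x * E (l k) y) / d $ k))"
    using d_pos by (intro sum.cong) (simp_all add: E field_simps)
  finally show ?thesis by (simp add: sum_negf)
qed

end

section \<open>From a line to a solution of the equations\<close>

text \<open>Here \<open>f\<close> holds the values of a complex linear form on the columns of the
  period matrix, \<open>h1\<close>, \<open>h2\<close>, \<open>h3\<close> being its values on the
  complex basis, while \<open>g\<close> is arbitrary. Linearity of \<open>f\<close> yields (1)-(6),
  and decomposability alone yields (8) and (9).\<close>

lemma decomposable_form_satisfies_equations: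
  fixes f :: "nat \<Rightarrow> complex" and g :: "nat \<Rightarrow> complex" and Z :: "complex^3^3"
  assumes sym: "transpose Z = Z"
    and f: "f 1 = h1" "f 2 = d2 * h2" "f 3 = d3 * h3"
      "f 4 = Z$1$1 * h1 + Z$2$1 * h2 + Z$3$1 * h3"
      "f 5 = Z$1$2 * h1 + Z$2$2 * h2 + Z$3$2 * h3"
      "f 6 = Z$1$3 * h1 + Z$2$3 * h2 + Z$3$3 * h3"
    and a: "\<And>i j. a i j = f i * g j - f j * g i"
    and trace: "d2 * d3 = - a 1 4 * d2 * d3 - a 3 6 * d2 - a 2 5 * d3"
  shows "elliptic_equations d2 d3 Z a"
proof -
  have s: "Z$2$1 = Z$1$2" "Z$3$1 = Z$1$3" "Z$3$2 = Z$2$3"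
    using arg_cong[OF sym, of "\<lambda>A. A$2$1"] arg_cong[OF sym, of "\<lambda>A. A$3$1"]
      arg_cong[OF sym, of "\<lambda>A. A$3$2"]
    by (simp_all add: transpose_def)
  show ?thesis
    unfolding elliptic_equations_def
    apply (intro conjI trace)
    subgoal unfolding a f s by (simp add: algebra_simps power2_eq_square)
    subgoal unfolding a f s by (simp add: algebra_simps power2_eq_square)
    subgoal unfolding a f s by (simp add: algebra_simps power2_eq_square)
    subgoal unfolding a f s by (simp add: algebra_simps power2_eq_square)
    subgoal unfolding a f s by (simp add: algebra_simps power2_eq_square)
    subgoal unfolding a f s by (simp add: algebra_simps power2_eq_square)
    subgoal unfolding a by (simp add: algebra_simps power2_eq_square)
    subgoal unfolding a by (simp add: algebra_simps power2_eq_square)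
    done
qed

text \<open>For \<open>x\<close>, \<open>y\<close> values of the linear form \<open>f = H(\<sqdot>, w)\<close>, the left side is
  \<open>E(\<sqdot>, z1 w) \<and> E(\<sqdot>, z2 w)\<close> and the right side a multiple of \<open>f \<and> cnj f\<close>.\<close>

lemma wedge_Im_eq:
  "of_real (Im (cnj z1 * x) * Im (cnj z2 * y) - Im (cnj z1 * y) * Im (cnj z2 * x)) =
     x * (\<i> * of_real (Im (cnj z1 * z2)) / 2 * cnj y) - y * (\<i> * of_real (Im (cnj z1 * z2)) / 2 * cnj x)"
  by (simp add: complex_eq_iff field_simps)

lemma line_imp_equations:
  fixes \<Lambda> :: "(complex ^ 3) set"
  assumes pb: "period_basis \<Lambda> H (vector [1, d2, d3]) Z e"
    and w: "w \<noteq> 0" and z: "Im (cnj z1 * z2) \<noteq> 0" "z1 *s w \<in> \<Lambda>" "z2 *s w \<in> \<Lambda>"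
  shows "\<exists>a :: nat \<Rightarrow> nat \<Rightarrow> rat. elliptic_equations (of_nat d2) (of_nat d3) Z (\<lambda>i j. of_rat (a i j))"
proof -
  interpret period_basis \<Lambda> H "vector [1, d2, d3]" Z e by (rule pb)
  have d: "d2 > 0" "d3 > 0" using d_pos[of 2] d_pos[of 3] by simp_all
  define b where "b n = [l 1, l 2, l 3, m 1, m 2, m 3] ! (n - 1)" for n :: nat
  have b: "b 1 = l 1" "b 2 = l 2" "b 3 = l 3" "b 4 = m 1" "b 5 = m 2" "b 6 = m 3"
    by (simp_all add: b_def)
  define u v where "u = z1 *s w" and "v = z2 *s w"
  have uv: "u \<in> \<Lambda>" "v \<in> \<Lambda>" using z by (simp_all add: u_def v_def)
  have E_uv: "E x u = Im (cnj z1 * H x w)" "E x v = Im (cnj z2 * H x w)" for x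
    by (simp_all add: u_def v_def H_scale_right)
  \<comment> \<open>On the line of \<open>w\<close> the form \<open>E\<close> is minus the
    determinant of the coordinates times the positive number \<open>Re (H w w)\<close>, so it does
    not vanish at \<open>u\<close>, \<open>v\<close>.\<close>
  have "E u v = Im (cnj z2 * z1) * Re (H w w)"
    using H_cnj[of w w] by (simp add: u_def v_def H_scale_left H_scale_right complex_eq_iff algebra_simps)
  moreover have "Im (cnj z2 * z1) = - Im (cnj z1 * z2)" by simp
  ultimately have "E u v = - Im (cnj z1 * z2) * Re (H w w)" by (simp only:)
  then have E_nz: "E u v \<noteq> 0" using z(1) H_pos[OF w] by (simp del: times_complex.sel)
  \<comment> \<open>The pairings are integers as real numbers; the floor moves them to the type
    \<open>int\<close>, so that the coefficients \<open>a\<close> can be rational.\<close>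
  define p q where "p n = \<lfloor>E (b n) u\<rfloor>" and "q n = \<lfloor>E (b n) v\<rfloor>" for n
  have pq: "of_int (p n) = E (b n) u" "of_int (q n) = E (b n) v" if "n \<in> {1,2,3,4,5,6}" for n
  proof -
    have "b n \<in> \<Lambda>" using that
      by (elim insertE emptyE) (simp_all only: b l_in_lattice m_in_lattice)
    then show "of_int (p n) = E (b n) u" "of_int (q n) = E (b n) v"
      using H_integral uv by (simp_all add: p_def q_def)
  qed
  define s where "s = \<lfloor>E u v\<rfloor>"
  have s: "of_int s = E u v" using H_integral uv by (simp add: s_def)
  \<comment> \<open>The value 0 off the indices 1 to 6, here and in \<open>a\<close>, lets
    \<open>a_fg\<close> hold for all \<open>i\<close> and \<open>j\<close>. Dividing
    \<open>a\<close> by \<open>E u v\<close> is the normalization that (7) requires.\<close>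
  define f where "f n = (if n \<in> {1,2,3,4,5,6} then H (b n) w else 0)" for n
  define a where "a i j = (if i \<in> {1,2,3,4,5,6} \<and> j \<in> {1,2,3,4,5,6} then
     of_int (p i * q j - p j * q i) / of_int s else 0 :: rat)" for i j
  \<comment> \<open>The factor of \<open>cnj (f n)\<close> is the one in \<open>wedge_Im_eq\<close>,
    divided by \<open>E u v\<close>.\<close>
  define g where "g n = \<i> * of_real (Im (cnj z1 * z2)) / 2 / of_real (E u v) * cnj (f n)" for n
  have a_fg: "of_rat (a i j) = f i * g j - f j * g i" for i j
  proof (cases "i \<in> {1,2,3,4,5,6} \<and> j \<in> {1,2,3,4,5,6}")
    case True
    then have "of_rat (a i j) = complex_of_real ((of_int (p i) * of_int (q j) - of_int (p j) * of_int (q i)) / of_int s)"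
      unfolding a_def by (simp add: of_rat_divide of_rat_diff of_rat_mult)
    also have "\<dots> = complex_of_real (Im (cnj z1 * f i) * Im (cnj z2 * f j) - Im (cnj z1 * f j) * Im (cnj z2 * f i))
         / of_real (E u v)"
      using True pq[of i] pq[of j] by (simp only: E_uv s f_def if_True of_real_divide)
    also have "\<dots> = f i * g j - f j * g i"
      unfolding wedge_Im_eq g_def by (simp add: diff_divide_distrib)
    finally show ?thesis .
  next
    case False
    then have "a i j = 0" "f i = 0 \<or> f j = 0" by (auto simp: a_def f_def)
    then show ?thesis by (auto simp: g_def)
  qed
  have "real d2 * real d3 = - ((E (b 1) u * E (b 4) v - E (b 4) u * E (b 1) v) / E u v) * real d2 * real d3
      - (E (b 3) u * E (b 6) v - E (b 6) u * E (b 3) v) / E u v * real d2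
      - (E (b 2) u * E (b 5) v - E (b 5) u * E (b 2) v) / E u v * real d3"
  proof -
    have aux: "y2 * y3 = - (k1 / t) * y2 * y3 - k3 / t * y2 - k2 / t * y3"
      if "k1 + k2 / y2 + k3 / y3 = - t" "t \<noteq> 0" "y2 \<noteq> 0" "y3 \<noteq> 0" for k1 k2 k3 t y2 y3 :: real
    proof -
      have "- t * y2 * y3 = k1 * y2 * y3 + k2 * y3 + k3 * y2"
        using that(3,4) unfolding that(1)[symmetric] by (simp add: field_simps)
      moreover have "t * (- (k1 / t) * y2 * y3 - k3 / t * y2 - k2 / t * y3) = - (k1 * y2 * y3 + k2 * y3 + k3 * y2)"
        using that(2) by (simp add: right_diff_distrib)
      ultimately have "t * (y2 * y3) = t * (- (k1 / t) * y2 * y3 - k3 / t * y2 - k2 / t * y3)"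
        by (simp only:)
      with that(2) show ?thesis by (simp only: mult_cancel_left) simp
    qed
    show ?thesis
      using E_symplectic_expansion[OF uv] unfolding sum_3 b
      by (intro aux) (use E_nz d in simp_all)
  qed
  moreover have "real_of_rat (a i j) = (E (b i) u * E (b j) v - E (b j) u * E (b i) v) / E u v"
    if "i \<in> {1,2,3,4,5,6}" "j \<in> {1,2,3,4,5,6}" for i j
  proof -
    have "a i j = of_int (p i * q j - p j * q i) / of_int s"
      unfolding a_def using that by (simp only: simp_thms if_True)
    then show ?thesis
      by (simp only: of_rat_divide of_rat_diff of_rat_mult of_rat_of_int_eq of_int_diff of_int_mult pq[OF that(1)] pq[OF that(2)] s)
  qed
  ultimately have "real d2 * real d3 = of_rat (- a 1 4 * of_nat d2 * of_nat d3 - a 3 6 * of_nat d2 - a 2 5 * of_nat d3)"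
    by (simp only: of_rat_diff of_rat_mult of_rat_minus of_rat_of_nat_eq insert_iff simp_thms)
  \<comment> \<open>Injectivity of \<open>of_rat\<close> brings the real identity down to the
    rationals, from where it maps to the complex numbers.\<close>
  then have "(of_rat (of_nat d2 * of_nat d3) :: real)
      = of_rat (- a 1 4 * of_nat d2 * of_nat d3 - a 3 6 * of_nat d2 - a 2 5 * of_nat d3)"
    by (simp add: of_rat_mult)
  then have "of_nat d2 * of_nat d3 = - a 1 4 * of_nat d2 * of_nat d3 - a 3 6 * of_nat d2 - a 2 5 * of_nat d3"
    unfolding of_rat_eq_iff .
  then have "complex_of_rat (of_nat d2 * of_nat d3)
      = of_rat (- a 1 4 * of_nat d2 * of_nat d3 - a 3 6 * of_nat d2 - a 2 5 * of_nat d3)"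
    by (simp only:)
  then have trace: "complex_of_nat d2 * of_nat d3 = - of_rat (a 1 4) * of_nat d2 * of_nat d3
      - of_rat (a 3 6) * of_nat d2 - of_rat (a 2 5) * of_nat d3"
    by (simp only: of_rat_mult of_rat_diff of_rat_minus of_rat_of_nat_eq)
  have f_eq: "f 1 = H (l 1) w" "f 2 = H (l 2) w" "f 3 = H (l 3) w"
    "f 4 = H (m 1) w" "f 5 = H (m 2) w" "f 6 = H (m 3) w"
    unfolding f_def b by simp_all
  have l_eq: "l 1 = e 1" "l 2 = of_nat d2 *s e 2" "l 3 = of_nat d3 *s e 3"
    unfolding l_def by simp_all
  have "elliptic_equations (of_nat d2) (of_nat d3) Z (\<lambda>i j. of_rat (a i j))"
    by (rule decomposable_form_satisfies_equations[of Z f "H (e 1) w" _ "H (e 2) w" _ "H (e 3) w",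
          OF Z_sym _ _ _ _ _ _ a_fg trace])
       (simp_all only: f_eq l_eq m_def sum_3 H_scale_left H_add_left)
  then show ?thesis by blast
qed

section \<open>From a solution of the equations to a line\<close>

context period_basis
begin

lemma complex_span_e:
  assumes "vec.subspace S" "\<And>i. e i \<in> S"
  shows "x \<in> S"
proof -
  have "vec.span (range e) \<subseteq> S" using assms by (intro vec.span_minimal) auto
  then show ?thesis using e_span by blast
qed

lemma e_coefficients_zero:
  assumes "(\<Sum>i\<in>UNIV. c i *s e i) = 0"
  shows "c i = 0"
proof -
  have "(\<Sum>v\<in>range e. c (inv_into UNIV e v) *s v) = 0"
    using assms by (simp add: sum.reindex[OF e_inj] e_inj)
  from vec.independentD[OF e_indep _ _ this, of "e i"] show ?thesis by (simp add: e_inj)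
qed

text \<open>The passage from real lattice coordinates to complex coordinates is multiplication by
  the period matrix; the denominators \<open>d k\<close> cancel its diagonal block.\<close>

lemma real_combination_eq:
  "(\<Sum>k\<in>UNIV. (\<alpha> k / d $ k) *\<^sub>R l k) + (\<Sum>k\<in>UNIV. \<beta> k *\<^sub>R m k) =
     (\<Sum>j\<in>UNIV. (of_real (\<alpha> j) + (\<Sum>k\<in>UNIV. Z $ j $ k * of_real (\<beta> k))) *s e j)"
proof -
  have "(\<alpha> k / d $ k) *\<^sub>R l k = of_real (\<alpha> k) *s e k" for k
    using d_pos[of k] by (simp add: scaleR_eq_vec_scale l_def)
  moreover have "(\<Sum>k\<in>UNIV. \<beta> k *\<^sub>R m k) = (\<Sum>j\<in>UNIV. (\<Sum>k\<in>UNIV. Z $ j $ k * of_real (\<beta> k)) *s e j)"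
    unfolding m_def scaleR_eq_vec_scale vec.scale_sum_right vec.scale_sum_left
    by (subst sum.swap) (simp add: mult.commute)
  ultimately show ?thesis
    by (simp add: vec.scale_left_distrib sum.distrib)
qed

section \<open>The rational span of the lattice\<close>

definition commensurable :: "complex ^ 'n \<Rightarrow> bool" where
  "commensurable x \<longleftrightarrow> (\<exists>n>0. real n *\<^sub>R x \<in> \<Lambda>)"

lemma lattice_nat_multiple: "real n *\<^sub>R x \<in> \<Lambda>" if "x \<in> \<Lambda>"
  by (induction n) (use that lattice lattice_zero lattice_add in \<open>auto simp: algebra_simps\<close>)

lemma lattice_int_multiple: "of_int n *\<^sub>R x \<in> \<Lambda>" if "x \<in> \<Lambda>"
  using lattice_nat_multiple[OF that, of "nat n"]
    lattice_minus[OF lattice lattice_nat_multiple[OF that, of "nat (- n)"]]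
  by (cases "n \<ge> 0") auto

lemma commensurable_add:
  assumes "commensurable x" "commensurable y" shows "commensurable (x + y)"
proof -
  from assms obtain n k where n: "n > 0" "real n *\<^sub>R x \<in> \<Lambda>" and k: "k > 0" "real k *\<^sub>R y \<in> \<Lambda>"
    unfolding commensurable_def by blast
  from lattice_add[OF lattice lattice_nat_multiple[OF n(2), of k] lattice_nat_multiple[OF k(2), of n]]
  have "real (n * k) *\<^sub>R (x + y) \<in> \<Lambda>" by (simp add: scaleR_add_right mult.commute)
  moreover have "n * k > 0" using n(1) k(1) by simp
  ultimately show ?thesis unfolding commensurable_def by blast
qed

lemma commensurable_sum:
  assumes "\<And>i. i \<in> A \<Longrightarrow> commensurable (f i)" shows "commensurable (sum f A)"
  using assms
proof (induction A rule: infinite_finite_induct)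
  case (insert x F)
  then show ?case by (simp add: commensurable_add)
qed (auto simp: commensurable_def lattice_zero[OF lattice])

lemma commensurable_rat_multiple:
  assumes "r \<in> \<rat>" "x \<in> \<Lambda>" shows "commensurable (r *\<^sub>R x)"
proof -
  from assms(1) obtain a b :: int where b: "b > 0" "r = of_int a / of_int b"
    by (rule Rats_cases')
  have "real (nat b) *\<^sub>R (r *\<^sub>R x) \<in> \<Lambda>"
    using lattice_int_multiple[OF assms(2), of a] b by simp
  moreover have "nat b > 0" using b(1) by simp
  ultimately show ?thesis unfolding commensurable_def by blast
qed

end

text \<open>\<open>P\<close>, \<open>Q\<close>, \<open>R\<close> are the blocks of an alternating form \<open>\<alpha>\<close> in the lattice basis, \<open>T\<close> is determined
  by \<open>\<alpha>(x, y) = E(T x, y)\<close>, and \<open>riemann\<close> says that \<open>\<alpha>\<close> has type \<open>(1,1)\<close>, so that \<open>T\<close> is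
  complex linear.\<close>

locale riemann_form_endomorphism = period_basis \<Lambda> H d Z e
  for \<Lambda> :: "(complex ^ 'n) set" and H d Z e +
  fixes P Q R :: "'n \<Rightarrow> 'n \<Rightarrow> real" and M :: "complex ^ 'n ^ 'n" and T :: "complex ^ 'n \<Rightarrow> complex ^ 'n"
  assumes rational: "P i j \<in> \<rat>" "Q i j \<in> \<rat>" "R i j \<in> \<rat>"
    and P_skew: "P i j = - P j i" and R_skew: "R i j = - R j i"
    and riemann: "complex_of_real (R i k) = (\<Sum>j\<in>UNIV. Z $ j $ i * (of_real (Q j k) / of_nat (d $ j)))
      - (\<Sum>j\<in>UNIV. Z $ k $ j * (of_real (Q j i) / of_nat (d $ j)))
      - (\<Sum>j\<in>UNIV. Z $ j $ i * (\<Sum>h\<in>UNIV. Z $ k $ h * (of_real (P j h) / of_nat (d $ h))) / of_nat (d $ j))"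
    and M: "M $ j $ i = (- of_real (Q i j) + (\<Sum>k\<in>UNIV. Z $ j $ k * (of_real (P i k) / of_nat (d $ k))))
      / of_nat (d $ i)"
    and T_add: "T (x + y) = T x + T y" and T_scale: "T (c *s x) = c *s T x"
    and T_e: "T (e k) = (\<Sum>j\<in>UNIV. M $ j $ k *s e j)"
begin

section \<open>The self-adjoint endomorphism attached to an alternating form\<close>

lemma T_scaleR: "T (r *\<^sub>R x) = r *\<^sub>R T x"
  by (simp add: scaleR_eq_vec_scale T_scale)

lemma T_zero: "T 0 = 0"
  using T_scale[of 0 0] by simp

lemma T_sum: "T (sum f A) = (\<Sum>i\<in>A. T (f i))"
  by (induction A rule: infinite_finite_induct) (simp_all add: T_zero T_add)

lemma T_e_combination:
  "T (\<Sum>j\<in>UNIV. c j *s e j) = (\<Sum>i\<in>UNIV. (\<Sum>j\<in>UNIV. M $ i $ j * c j) *s e i)"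
  unfolding T_sum T_scale T_e vec.scale_sum_right vec.scale_sum_left
  by (subst sum.swap) (simp add: mult.commute)

text \<open>These coefficients are forced by \<alpha>(l i, y) = E(T (l i), y) for \<open>y\<close>
  in the lattice basis, and \<open>M\<close> is the matrix chosen to produce them.\<close>

lemma T_l:
  "T (l i) = (\<Sum>k\<in>UNIV. (- Q i k / d $ k) *\<^sub>R l k) + (\<Sum>k\<in>UNIV. (P i k / d $ k) *\<^sub>R m k)"
  unfolding real_combination_eq unfolding l_def T_scale T_e vec.scale_sum_right
  using d_pos[of i] by (intro sum.cong) (simp_all add: M)

text \<open>Complex linearity already determines \<open>T\<close> on \<open>m i\<close> from its
  values on \<open>e\<close>. That the result is the one prescribed by \<alpha> is exactly
  \<open>riemann\<close>.\<close>

lemma T_m: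
  "T (m i) = (\<Sum>k\<in>UNIV. (- R i k / d $ k) *\<^sub>R l k) + (\<Sum>k\<in>UNIV. (- Q k i / d $ k) *\<^sub>R m k)"
proof -
  have "(\<Sum>j\<in>UNIV. M $ k $ j * Z $ j $ i) =
      of_real (- R i k) + (\<Sum>j\<in>UNIV. Z $ k $ j * of_real (- Q j i / d $ j))" for k
    by (simp add: M riemann sum_negf sum_subtractf[symmetric] sum.distrib[symmetric] algebra_simps
        diff_divide_distrib add_divide_distrib)
  then show ?thesis
    unfolding real_combination_eq unfolding m_def T_e_combination by simp
qed

lemma E_T_basis:
  "E (l j) (T (l i)) = - P i j" "E (m j) (T (l i)) = - Q i j"
  "E (l j) (T (m i)) = Q j i" "E (m j) (T (m i)) = - R i j"
  unfolding T_l T_m E_l_coordinates E_m_coordinates using d_pos[of j] by simp_all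

text \<open>This is the skew symmetry of \<alpha>: E(T x, y) = \<alpha>(x, y) = -\<alpha>(y, x) =
  E(x, T y). It is checked on the lattice basis, one variable at a time.\<close>

lemma T_E_selfadjoint: "E (T x) y = E x (T y)"
proof -
  have left: "subspace {x. E (T x) y = E x (T y)}" for y
    by (rule subspaceI) (simp_all add: T_zero T_add T_scaleR H_zero_left H_add_left H_scaleR_left)
  have right: "subspace {y. E (T x) y = E x (T y)}" for x
    by (rule subspaceI) (simp_all add: T_zero T_add T_scaleR H_zero_right H_add_right H_scaleR_right)
  have basis: "E (T (l i)) (l j) = E (l i) (T (l j))" "E (T (m i)) (l j) = E (m i) (T (l j))"
    "E (T (l i)) (m j) = E (l i) (T (m j))" "E (T (m i)) (m j) = E (m i) (T (m j))" for i j
    unfolding E_swap[of "T (l i)"] E_swap[of "T (m i)"] E_T_basis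
    using P_skew[of i j] R_skew[of i j] by (simp_all only: minus_minus)
  have "x \<in> {x. E (T x) (l j) = E x (T (l j))}" for j x
    by (rule real_span_l_m[OF left]) (simp_all only: mem_Collect_eq basis)
  moreover have "x \<in> {x. E (T x) (m j) = E x (T (m j))}" for j x
    by (rule real_span_l_m[OF left]) (simp_all only: mem_Collect_eq basis)
  ultimately have lm: "E (T x) (l j) = E x (T (l j))" "E (T x) (m j) = E x (T (m j))" for j x by blast+
  have "y \<in> {y. E (T x) y = E x (T y)}"
    by (rule real_span_l_m[OF right]) (simp_all only: mem_Collect_eq lm)
  then show ?thesis by simp
qed

text \<open>The real part of \<open>H x y\<close> is \<open>E\<close> at (i x, y), and
  \<open>T\<close> commutes with multiplication by i.\<close>

lemma T_selfadjoint: "H (T x) y = H x (T y)"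
proof (rule complex_eqI)
  have "Re (H (T x) y) = E (T (\<i> *s x)) y" by (simp add: T_scale H_scale_left)
  also have "\<dots> = E (\<i> *s x) (T y)" by (rule T_E_selfadjoint)
  finally show "Re (H (T x) y) = Re (H x (T y))" by (simp add: H_scale_left)
qed (rule T_E_selfadjoint)

lemma T_T_e: "T (T (e k)) = (\<Sum>j\<in>UNIV. (M ** M) $ j $ k *s e j)"
  by (simp add: T_e T_e_combination matrix_matrix_mult_def)

lemma T_T_T_e: "T (T (T (e k))) = (\<Sum>j\<in>UNIV. (M ** (M ** M)) $ j $ k *s e j)"
  by (simp add: T_T_e T_e_combination matrix_matrix_mult_def)

text \<open>A self-adjoint operator with \<open>T\<^sup>3 = T\<^sup>2\<close> satisfies \<open>|T\<^sup>2 x - T x|\<^sup>2 = 0\<close>.\<close>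

lemma T_idempotent:
  assumes "M ** (M ** M) = M ** M"
  shows "T (T x) = T x"
proof -
  have "vec.subspace {x. T (T (T x)) = T (T x)}"
    by (rule vec.subspaceI) (simp_all add: T_zero T_add T_scale)
  then have "x \<in> {x. T (T (T x)) = T (T x)}" for x
    by (rule complex_span_e) (unfold mem_Collect_eq, rule trans[OF T_T_T_e], simp only: T_T_e assms)
  then have cube: "T (T (T x)) = T (T x)" for x by blast
  \<comment> \<open>Moving every \<open>T\<close> to the second argument turns the expansion into
    \<open>H x (T^4 x - 2 T^3 x + T^2 x)\<close>, which \<open>cube\<close> makes zero.\<close>
  have "H (T (T x) - T x) (T (T x) - T x) = 0"
    by (simp add: H_diff_left H_diff_right T_selfadjoint cube)
  then have "T (T x) - T x = 0" using H_pos[of "T (T x) - T x"] by force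
  then show ?thesis by simp
qed

lemma M_idempotent:
  assumes "M ** (M ** M) = M ** M"
  shows "M ** M = M"
proof -
  have "(M ** M) $ i $ k - M $ i $ k = 0" for i k
  proof (rule e_coefficients_zero[where c = "\<lambda>i. (M ** M) $ i $ k - M $ i $ k"])
    have "(\<Sum>i\<in>UNIV. ((M ** M) $ i $ k - M $ i $ k) *s e i) = T (T (e k)) - T (e k)"
      by (simp only: T_T_e) (simp add: T_e vec.scale_left_diff_distrib sum_subtractf)
    then show "(\<Sum>i\<in>UNIV. ((M ** M) $ i $ k - M $ i $ k) *s e i) = 0"
      by (simp add: T_idempotent[OF assms])
  qed
  then show ?thesis by (simp add: vec_eq_iff)
qed

lemma commensurable_T_l: "commensurable (T (l i))"
  and commensurable_T_m: "commensurable (T (m i))"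
  unfolding T_l T_m
  by (intro commensurable_add commensurable_sum commensurable_rat_multiple l_in_lattice m_in_lattice
      Rats_divide Rats_minus_iff[THEN iffD2] rational Rats_of_nat)+

text \<open>All values of \<open>T\<close> are multiples \<open>F x *s w\<close> of one column image
  \<open>w\<close>. Idempotence gives \<open>F w = 1\<close>, so \<open>F\<close> is onto the plane
  and two lattice basis vectors have independent values under \<open>F\<close>. Their images under
  \<open>T\<close> are commensurable with the lattice, and clearing denominators puts multiples of
  them into it.\<close>

lemma rank_one_imp_line:
  assumes M: "M ** M = M" and k: "M $ k $ k \<noteq> 0"
    and rank: "\<And>i j. M $ j $ i * M $ k $ k = M $ j $ k * M $ k $ i"
  obtains w z1 z2 where "w \<noteq> 0" "Im (cnj z1 * z2) \<noteq> 0" "z1 *s w \<in> \<Lambda>" "z2 *s w \<in> \<Lambda>"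
proof -
  define w where "w = T (e k)"
  have w: "w \<noteq> 0"
    using e_coefficients_zero[of "\<lambda>j. M $ j $ k" k] k unfolding w_def T_e by blast
  have "vec.subspace {x. \<exists>c. T x = c *s w}"
  proof (rule vec.subspaceI)
    show "0 \<in> {x. \<exists>c. T x = c *s w}" by (auto simp: T_zero intro: exI[of _ 0])
  next
    fix x y assume "x \<in> {x. \<exists>c. T x = c *s w}" "y \<in> {x. \<exists>c. T x = c *s w}"
    then obtain a b where "T x = a *s w" "T y = b *s w" by blast
    then have "T (x + y) = (a + b) *s w" by (simp add: T_add vec.scale_left_distrib)
    then show "x + y \<in> {x. \<exists>c. T x = c *s w}" by blast
  next
    fix r x assume "x \<in> {x. \<exists>c. T x = c *s w}"
    then obtain a where "T x = a *s w" by blast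
    then have "T (r *s x) = (r * a) *s w" by (simp add: T_scale)
    then show "r *s x \<in> {x. \<exists>c. T x = c *s w}" by blast
  qed
  moreover have "e i \<in> {x. \<exists>c. T x = c *s w}" for i
  proof (rule CollectI, rule exI)
    show "T (e i) = (M $ k $ i / M $ k $ k) *s w"
      unfolding w_def T_e vec.scale_sum_right
      using rank k by (intro sum.cong) (simp_all add: field_simps)
  qed
  ultimately have "x \<in> {x. \<exists>c. T x = c *s w}" for x
    by (rule complex_span_e)
  then have ex: "\<exists>c. T x = c *s w" for x by blast
  \<comment> \<open>The coordinate along \<open>w\<close> is unique because
    \<open>w \<noteq> 0\<close>; this is what makes \<open>F\<close> additive and real
    homogeneous.\<close>
  define F where "F x = (SOME c. T x = c *s w)" for x
  have F: "T x = F x *s w" for x unfolding F_def by (rule someI_ex) (rule ex)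
  have F_add: "F (x + y) = F x + F y" for x y
    using T_add[of x y] w unfolding F
    by (simp only: vec.scale_left_distrib[symmetric] vec.scale_cancel_right) simp
  have F_scaleR: "F (r *\<^sub>R x) = of_real r * F x" for r x
    using T_scaleR[of r x] w unfolding F scaleR_eq_vec_scale vec.scale_scale by simp
  have F_zero: "F 0 = 0" using F_scaleR[of 0] by simp
  have "T w = w" unfolding w_def by (rule trans[OF T_T_e]) (simp only: T_e M)
  then have "F w *s w = 1 *s w" using F[of w] by simp
  then have F_w: "F w = 1" using w by (metis vec.scale_cancel_right)
  have "F (\<i> *s w) *s w = \<i> *s w" by (simp only: F[symmetric] T_scale \<open>T w = w\<close>)
  then have F_iw: "F (\<i> *s w) = \<i>" using w by (metis vec.scale_cancel_right)
  define B where "B = range l \<union> range m"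
  have span: "x \<in> S" if "subspace S" "B \<subseteq> S" for x S
    by (rule real_span_l_m[OF that(1)]) (use that(2) in \<open>auto simp: B_def\<close>)
  have "\<exists>x\<in>B. F x \<noteq> 0"
  proof (rule ccontr)
    assume "\<not> ?thesis"
    then have "B \<subseteq> {x. F x = 0}" by blast
    moreover have "subspace {x. F x = 0}"
      by (rule subspaceI) (simp_all add: F_zero F_add F_scaleR)
    ultimately have "w \<in> {x. F x = 0}" using span by blast
    with F_w show False by simp
  qed
  then obtain x where x: "x \<in> B" "F x \<noteq> 0" by blast
  \<comment> \<open>Since \<open>F\<close> takes the values 1 and i, its values on the real spanning
    set \<open>B\<close> cannot all lie on the real line through \<open>F x\<close>.\<close>
  have "\<exists>y\<in>B. Im (cnj (F x) * F y) \<noteq> 0"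
  proof (rule ccontr)
    assume "\<not> ?thesis"
    then have "B \<subseteq> {y. Im (cnj (F x) * F y) = 0}" by blast
    moreover have "subspace {y. Im (cnj (F x) * F y) = 0}"
      by (rule subspaceI) (simp_all add: F_zero F_add F_scaleR algebra_simps)
    ultimately have "y \<in> {y. Im (cnj (F x) * F y) = 0}" for y
      using span by blast
    from this[of w] this[of "\<i> *s w"] have "F x = 0"
      by (simp add: F_w F_iw complex_eq_iff)
    with x(2) show False by simp
  qed
  then obtain y where y: "y \<in> B" "Im (cnj (F x) * F y) \<noteq> 0" by blast
  have "commensurable (T x)" "commensurable (T y)"
    using x(1) y(1) commensurable_T_l commensurable_T_m by (auto simp: B_def)
  then obtain n1 n2 where n: "n1 > 0" "real n1 *\<^sub>R T x \<in> \<Lambda>" "n2 > 0" "real n2 *\<^sub>R T y \<in> \<Lambda>"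
    unfolding commensurable_def by blast
  show thesis
  proof (rule that[OF w])
    show "(of_real (real n1) * F x) *s w \<in> \<Lambda>" "(of_real (real n2) * F y) *s w \<in> \<Lambda>"
      using n(2,4) by (simp_all add: F scaleR_eq_vec_scale)
    have "Im (cnj (of_real (real n1) * F x) * (of_real (real n2) * F y)) =
        real n1 * real n2 * Im (cnj (F x) * F y)" by (simp add: algebra_simps)
    then show "Im (cnj (of_real (real n1) * F x) * (of_real (real n2) * F y)) \<noteq> 0"
      using n(1,3) y(2) by (simp del: times_complex.sel)
  qed
qed

end

section \<open>Characteristic polynomials of 3 by 3 matrices\<close>

lemma forall_3_3: "(\<forall>(i :: 3) (j :: 3). A i j) \<longleftrightarrow>
    A 1 1 \<and> A 1 2 \<and> A 1 3 \<and> A 2 1 \<and> A 2 2 \<and> A 2 3 \<and> A 3 1 \<and> A 3 2 \<and> A 3 3"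
  by (auto simp: forall_3)

text \<open>The second elementary symmetric function of the eigenvalues, which is the linear
  coefficient of the characteristic polynomial.\<close>

definition principal_minor_sum :: "complex ^ 3 ^ 3 \<Rightarrow> complex" where
  "principal_minor_sum M = M$1$1 * M$2$2 - M$1$2 * M$2$1 + (M$1$1 * M$3$3 - M$1$3 * M$3$1)
     + (M$2$2 * M$3$3 - M$2$3 * M$3$2)"

lemma cayley_hamilton_3:
  fixes M :: "complex ^ 3 ^ 3"
  shows "(M ** (M ** M)) $ i $ j = trace M * (M ** M) $ i $ j - principal_minor_sum M * M $ i $ j
    + (if i = j then det M else 0)"
proof -
  have "\<forall>i j. (M ** (M ** M)) $ i $ j = trace M * (M ** M) $ i $ j - principal_minor_sum M * M $ i $ j
    + (if i = j then det M else 0)"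
    unfolding forall_3_3 trace_def principal_minor_sum_def det_3 matrix_matrix_mult_def
    by (simp add: sum_3) (simp add: algebra_simps)
  then show ?thesis by blast
qed

text \<open>The \<open>2 \<times> 2\<close> minors are the entries of the adjugate \<open>M\<^sup>2 - tr(M) M + e\<^sub>2(M) I\<close>.\<close>

lemma idempotent_trace_one_rank_one:
  fixes M :: "complex ^ 3 ^ 3"
  assumes M: "M ** M = M" and t: "trace M = 1" and e2: "principal_minor_sum M = 0"
  shows "\<exists>k. M $ k $ k \<noteq> 0 \<and> (\<forall>i j. M $ j $ i * M $ k $ k = M $ j $ k * M $ k $ i)"
proof -
  \<comment> \<open>Under the assumptions the adjugate is zero. The constant \<open>c\<close> is 1
    for its diagonal entries and 0 for the others.\<close>
  have adj: "(M ** M) $ i $ j - trace M * M $ i $ j + c * principal_minor_sum M = 0"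
    for i j c by (simp add: M t e2)
  note unf = trace_def principal_minor_sum_def matrix_matrix_mult_def sum_3 vec_lambda_beta
  have minors: "M$2$2 * M$3$3 = M$2$3 * M$3$2" "M$1$3 * M$3$2 = M$1$2 * M$3$3" "M$1$2 * M$2$3 = M$1$3 * M$2$2"
    "M$2$3 * M$3$1 = M$2$1 * M$3$3" "M$1$1 * M$3$3 = M$1$3 * M$3$1" "M$1$3 * M$2$1 = M$1$1 * M$2$3"
    "M$2$1 * M$3$2 = M$2$2 * M$3$1" "M$1$2 * M$3$1 = M$1$1 * M$3$2" "M$1$1 * M$2$2 = M$1$2 * M$2$1"
    subgoal using adj[of 1 1 1] unfolding unf by (simp add: algebra_simps)
    subgoal using adj[of 1 2 0] unfolding unf by (simp add: algebra_simps)
    subgoal using adj[of 1 3 0] unfolding unf by (simp add: algebra_simps)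
    subgoal using adj[of 2 1 0] unfolding unf by (simp add: algebra_simps)
    subgoal using adj[of 2 2 1] unfolding unf by (simp add: algebra_simps)
    subgoal using adj[of 2 3 0] unfolding unf by (simp add: algebra_simps)
    subgoal using adj[of 3 1 0] unfolding unf by (simp add: algebra_simps)
    subgoal using adj[of 3 2 0] unfolding unf by (simp add: algebra_simps)
    subgoal using adj[of 3 3 1] unfolding unf by (simp add: algebra_simps)
    done
  have "\<forall>k. \<forall>i j. M $ j $ i * M $ k $ k = M $ j $ k * M $ k $ i"
    unfolding forall_3 using minors by (simp add: mult.commute)
  moreover have "\<exists>k. M $ k $ k \<noteq> 0"
  proof (rule ccontr)
    assume "\<not> ?thesis"
    with t show False by (simp add: trace_def)
  qed
  ultimately show ?thesis by blast
qed

text \<open>Written in a basis adapted to the Hodge decomposition, \<open>\<alpha> - t E\<close> has a vanishing diagonal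
  block, so its Pfaffian is the characteristic polynomial of \<open>M\<close>.\<close>

lemma pfaffian_characteristic_polynomial:
  fixes M :: "complex ^ 3 ^ 3"
  assumes M: "M$1$1 = - q11 + t12 * p12 + t13 * p13" "M$1$2 = - q21 - t11 * p12 + t13 * p23"
    "M$1$3 = - q31 - t11 * p13 - t12 * p23" "M$2$1 = - q12 + t22 * p12 + t23 * p13"
    "M$2$2 = - q22 - t12 * p12 + t23 * p23" "M$2$3 = - q32 - t12 * p13 - t22 * p23"
    "M$3$1 = - q13 + t23 * p12 + t33 * p13" "M$3$2 = - q23 - t13 * p12 + t33 * p23"
    "M$3$3 = - q33 - t13 * p13 - t23 * p23"
    and r: "r12 = t11 * q12 + t12 * q22 + t13 * q32 - (t12 * q11 + t22 * q21 + t23 * q31)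
      - (t11 * t22 - t12 * t12) * p12 - (t11 * t23 - t13 * t12) * p13 - (t12 * t23 - t13 * t22) * p23"
    "r13 = t11 * q13 + t12 * q23 + t13 * q33 - (t13 * q11 + t23 * q21 + t33 * q31)
      - (t11 * t23 - t12 * t13) * p12 - (t11 * t33 - t13 * t13) * p13 - (t12 * t33 - t13 * t23) * p23"
    "r23 = t12 * q13 + t22 * q23 + t23 * q33 - (t13 * q12 + t23 * q22 + t33 * q32)
      - (t12 * t23 - t22 * t13) * p12 - (t12 * t33 - t23 * t13) * p13 - (t22 * t33 - t23 * t23) * p23"
  shows "trace M = - q11 - q22 - q33"
    and "principal_minor_sum M = - (p13 * r13 - q11 * q33 + q13 * q31) - (p12 * r12 - q11 * q22 + q12 * q21)
      - (p23 * r23 - q22 * q33 + q23 * q32)"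
    and "det M = p12 * (q31 * r23 - q32 * r13 + q33 * r12) - p13 * (q21 * r23 - q22 * r13 + q23 * r12)
      + q11 * (p23 * r23 - q22 * q33 + q23 * q32) - q12 * (p23 * r13 - q21 * q33 + q23 * q31)
      + q13 * (p23 * r12 - q21 * q32 + q22 * q31)"
  subgoal unfolding trace_def sum_3 M by (simp add: algebra_simps)
  subgoal unfolding principal_minor_sum_def M r by (simp add: algebra_simps)
  subgoal unfolding det_3 M r by (simp add: algebra_simps)
  done

text \<open>Each index 1, 2, 3 of \<open>a\<close> contributes a division by its diagonal entry of
  D. Then (4), (1), (2) are solved for \<open>r12\<close>, \<open>r13\<close>, \<open>r23\<close>,
  and (7), (8), (9) become the invariants that \<open>pfaffian_characteristic_polynomial\<close>
  identifies as trace, sum of principal minors and determinant.\<close>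

lemma elliptic_equations_normalized:
  assumes eqs: "elliptic_equations d2 d3 Z a" and d: "d2 \<noteq> 0" "d3 \<noteq> 0"
    and a: "a 1 2 = d2 * p12" "a 1 3 = d3 * p13" "a 2 3 = d2 * d3 * p23"
      "a 1 4 = q11" "a 1 5 = q12" "a 1 6 = q13" "a 2 4 = d2 * q21" "a 2 5 = d2 * q22" "a 2 6 = d2 * q23"
      "a 3 4 = d3 * q31" "a 3 5 = d3 * q32" "a 3 6 = d3 * q33" "a 4 5 = r12" "a 4 6 = r13" "a 5 6 = r23"
  shows "r12 = Z$1$1 * q12 + Z$1$2 * q22 + Z$1$3 * q32 - (Z$1$2 * q11 + Z$2$2 * q21 + Z$2$3 * q31)
      - (Z$1$1 * Z$2$2 - Z$1$2 * Z$1$2) * p12 - (Z$1$1 * Z$2$3 - Z$1$3 * Z$1$2) * p13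
      - (Z$1$2 * Z$2$3 - Z$1$3 * Z$2$2) * p23" (is ?r12)
    and "r13 = Z$1$1 * q13 + Z$1$2 * q23 + Z$1$3 * q33 - (Z$1$3 * q11 + Z$2$3 * q21 + Z$3$3 * q31)
      - (Z$1$1 * Z$2$3 - Z$1$2 * Z$1$3) * p12 - (Z$1$1 * Z$3$3 - Z$1$3 * Z$1$3) * p13
      - (Z$1$2 * Z$3$3 - Z$1$3 * Z$2$3) * p23" (is ?r13)
    and "r23 = Z$1$2 * q13 + Z$2$2 * q23 + Z$2$3 * q33 - (Z$1$3 * q12 + Z$2$3 * q22 + Z$3$3 * q32)
      - (Z$1$2 * Z$2$3 - Z$2$2 * Z$1$3) * p12 - (Z$1$2 * Z$3$3 - Z$2$3 * Z$1$3) * p13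
      - (Z$2$2 * Z$3$3 - Z$2$3 * Z$2$3) * p23" (is ?r23)
    and "- q11 - q22 - q33 = 1"
    and "- (p13 * r13 - q11 * q33 + q13 * q31) - (p12 * r12 - q11 * q22 + q12 * q21)
      - (p23 * r23 - q22 * q33 + q23 * q32) = 0" (is "?e2 = 0")
    and "p12 * (q31 * r23 - q32 * r13 + q33 * r12) - p13 * (q21 * r23 - q22 * r13 + q23 * r12)
      + q11 * (p23 * r23 - q22 * q33 + q23 * q32) - q12 * (p23 * r13 - q21 * q33 + q23 * q31)
      + q13 * (p23 * r12 - q21 * q32 + q22 * q31) = 0" (is "?e3 = 0")
proof -
  have cancel: "x = y" if "d2 * d3 * x = d2 * d3 * y" for x y :: complex
    using that d by simp
  note E = eqs[unfolded elliptic_equations_def a]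
  show ?r12 by (rule cancel) (use E[THEN conjunct2, THEN conjunct2, THEN conjunct2, THEN conjunct1] in
      \<open>simp add: algebra_simps power2_eq_square\<close>)
  show ?r13 by (rule cancel) (use E[THEN conjunct1] in \<open>simp add: algebra_simps power2_eq_square\<close>)
  show ?r23 by (rule cancel) (use E[THEN conjunct2, THEN conjunct1] in
      \<open>simp add: algebra_simps power2_eq_square\<close>)
  note E7 = E[THEN conjunct2, THEN conjunct2, THEN conjunct2, THEN conjunct2, THEN conjunct2, THEN conjunct2]
  show "- q11 - q22 - q33 = 1"
    by (rule cancel) (use E7[THEN conjunct1] in \<open>simp add: algebra_simps\<close>)
  have "2 * d2 * d3 * ?e2 = 0"
    using E7[THEN conjunct2, THEN conjunct1] by (simp add: algebra_simps)
  then show "?e2 = 0" using d by simp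
  have "3 * d2 * d3 * ?e3 = 0"
    using E7[THEN conjunct2, THEN conjunct2] by (simp add: algebra_simps)
  then show "?e3 = 0" using d by simp
qed

lemma of_real_of_rat: "of_real (of_rat x) = (of_rat x :: complex)"
  by (cases x) (simp add: of_rat_rat)

lemma equations_imp_line:
  fixes \<Lambda> :: "(complex ^ 3) set" and a :: "nat \<Rightarrow> nat \<Rightarrow> rat"
  assumes pb: "period_basis \<Lambda> H (vector [1, d2, d3]) Z e"
    and eqs: "elliptic_equations (of_nat d2) (of_nat d3) Z (\<lambda>i j. of_rat (a i j))"
  obtains w z1 z2 where "w \<noteq> 0" "Im (cnj z1 * z2) \<noteq> 0" "z1 *s w \<in> \<Lambda>" "z2 *s w \<in> \<Lambda>"
proof -
  interpret period_basis \<Lambda> H "vector [1, d2, d3]" Z e by (rule pb)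
  have d: "d2 > 0" "d3 > 0" using d_pos[of 2] d_pos[of 3] by simp_all
  define c2 c3 where "c2 = complex_of_nat d2" and "c3 = complex_of_nat d3"
  have c: "c2 \<noteq> 0" "c3 \<noteq> 0" using d by (simp_all add: c2_def c3_def)
  define b where "b i j = complex_of_rat (a i j)" for i j
  \<comment> \<open>The 6 by 6 alternating matrix with upper entries \<open>a\<close> has diagonal
    blocks \<open>P\<close>, \<open>R\<close> and upper right block \<open>Q\<close>; its lower left
    block is minus the transpose of \<open>Q\<close>.\<close>
  define P :: "3 \<Rightarrow> 3 \<Rightarrow> rat" where "P i j = (vector [vector [0, a 1 2, a 1 3],
    vector [- a 1 2, 0, a 2 3], vector [- a 1 3, - a 2 3, 0]] :: rat ^ 3 ^ 3) $ i $ j" for i j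
  define Q :: "3 \<Rightarrow> 3 \<Rightarrow> rat" where "Q i j = (vector [vector [a 1 4, a 1 5, a 1 6],
    vector [a 2 4, a 2 5, a 2 6], vector [a 3 4, a 3 5, a 3 6]] :: rat ^ 3 ^ 3) $ i $ j" for i j
  define R :: "3 \<Rightarrow> 3 \<Rightarrow> rat" where "R i j = (vector [vector [0, a 4 5, a 4 6],
    vector [- a 4 5, 0, a 5 6], vector [- a 4 6, - a 5 6, 0]] :: rat ^ 3 ^ 3) $ i $ j" for i j
  note blocks = P_def Q_def R_def vector_3 b_def[symmetric] of_rat_minus of_rat_0
    c2_def[symmetric] c3_def[symmetric] of_nat_1
  define M :: "complex ^ 3 ^ 3" where "M = (\<chi> j i. (- of_rat (Q i j)
      + (\<Sum>k\<in>UNIV. Z $ j $ k * (of_rat (P i k) / of_nat ((vector [1, d2, d3] :: nat ^ 3) $ k))))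
    / of_nat ((vector [1, d2, d3] :: nat ^ 3) $ i))"
  define p12 p13 p23 where "p12 = b 1 2 / c2" and "p13 = b 1 3 / c3" and "p23 = b 2 3 / (c2 * c3)"
  define q21 q22 q23 q31 q32 q33 where "q21 = b 2 4 / c2" and "q22 = b 2 5 / c2" and "q23 = b 2 6 / c2"
    and "q31 = b 3 4 / c3" and "q32 = b 3 5 / c3" and "q33 = b 3 6 / c3"
  note pq_def = p12_def p13_def p23_def q21_def q22_def q23_def q31_def q32_def q33_def
  have b_eq: "b 1 2 = c2 * p12" "b 1 3 = c3 * p13" "b 2 3 = c2 * c3 * p23"
    "b 2 4 = c2 * q21" "b 2 5 = c2 * q22" "b 2 6 = c2 * q23"
    "b 3 4 = c3 * q31" "b 3 5 = c3 * q32" "b 3 6 = c3 * q33"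
    using c by (simp_all add: pq_def)
  note norm = elliptic_equations_normalized[OF eqs[folded c2_def c3_def b_def] c b_eq(1-3) refl refl refl
      b_eq(4-9) refl refl refl]
  have Z': "Z $ 2 $ 1 = Z $ 1 $ 2" "Z $ 3 $ 1 = Z $ 1 $ 3" "Z $ 3 $ 2 = Z $ 2 $ 3"
    by (rule Z_swap)+
  have M_entries: "M$1$1 = - b 1 4 + Z$1$2 * p12 + Z$1$3 * p13" "M$1$2 = - q21 - Z$1$1 * p12 + Z$1$3 * p23"
    "M$1$3 = - q31 - Z$1$1 * p13 - Z$1$2 * p23" "M$2$1 = - b 1 5 + Z$2$2 * p12 + Z$2$3 * p13"
    "M$2$2 = - q22 - Z$1$2 * p12 + Z$2$3 * p23" "M$2$3 = - q32 - Z$1$2 * p13 - Z$2$2 * p23"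
    "M$3$1 = - b 1 6 + Z$2$3 * p12 + Z$3$3 * p13" "M$3$2 = - q23 - Z$1$3 * p12 + Z$3$3 * p23"
    "M$3$3 = - q33 - Z$1$3 * p13 - Z$2$3 * p23"
    unfolding M_def vec_lambda_beta sum_3 blocks Z' b_eq using c by (simp_all add: field_simps)
  note char = pfaffian_characteristic_polynomial[OF M_entries norm(1-3)]
  have t: "trace M = 1" unfolding char(1) by (rule norm(4))
  have e2: "principal_minor_sum M = 0" unfolding char(2) by (rule norm(5))
  have e3: "det M = 0" unfolding char(3) by (rule norm(6))
  \<comment> \<open>The characteristic polynomial is X^3 - X^2, so this is the Cayley-Hamilton
    theorem.\<close>
  have cube: "M ** (M ** M) = M ** M"
    by (simp add: vec_eq_iff cayley_hamilton_3 t e2 e3)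
  \<comment> \<open>The endomorphism is prescribed on the complex basis;
    \<open>inv_into UNIV e\<close> recovers the index of a basis vector.\<close>
  obtain T where T: "Vector_Spaces.linear (*s) (*s) T"
    and T_e: "\<forall>x\<in>range e. T x = (\<Sum>j\<in>UNIV. M $ j $ (inv_into UNIV e x) *s e j)"
    using vec.linear_independent_extend[OF e_indep,
        of "\<lambda>x. \<Sum>j\<in>UNIV. M $ j $ (inv_into UNIV e x) *s e j"] by blast
  interpret T: Vector_Spaces.linear "(*s)" "(*s)" T by (rule T)
  \<comment> \<open>With the inverses treated as atoms, the nine entries of \<open>riem\<close>
    become polynomial identities.\<close>
  define i2 i3 where "i2 = inverse c2" and "i3 = inverse c3"
  note inv_def = i2_def[symmetric] i3_def[symmetric]
  have riem: "\<forall>i k. complex_of_rat (R i k) =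
      (\<Sum>j\<in>UNIV. Z $ j $ i * (of_rat (Q j k) / of_nat ((vector [1, d2, d3] :: nat ^ 3) $ j)))
      - (\<Sum>j\<in>UNIV. Z $ k $ j * (of_rat (Q j i) / of_nat ((vector [1, d2, d3] :: nat ^ 3) $ j)))
      - (\<Sum>j\<in>UNIV. Z $ j $ i * (\<Sum>h\<in>UNIV. Z $ k $ h *
          (of_rat (P j h) / of_nat ((vector [1, d2, d3] :: nat ^ 3) $ h)))
        / of_nat ((vector [1, d2, d3] :: nat ^ 3) $ j))"
    unfolding forall_3_3 sum_3 blocks Z' norm(1-3) pq_def divide_inverse inverse_mult_distrib inv_def
    by (intro conjI) (simp_all add: algebra_simps)
  interpret riemann_form_endomorphism \<Lambda> H "vector [1, d2, d3]" Z e
    "\<lambda>i j. of_rat (P i j)" "\<lambda>i j. of_rat (Q i j)" "\<lambda>i j. of_rat (R i j)" M T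
  proof unfold_locales
    have skew: "\<forall>i j. P i j = - P j i" "\<forall>i j. R i j = - R j i"
      unfolding forall_3_3 by (simp_all only: P_def R_def vector_3 minus_minus minus_zero)
    show "real_of_rat (P i j) = - of_rat (P j i)" "real_of_rat (R i j) = - of_rat (R j i)" for i j
      using arg_cong[OF skew(1)[rule_format, of i j], of real_of_rat]
        arg_cong[OF skew(2)[rule_format, of i j], of real_of_rat]
      by (simp_all only: of_rat_minus)
    show "complex_of_real (of_rat (R i k)) =
      (\<Sum>j\<in>UNIV. Z $ j $ i * (of_real (of_rat (Q j k)) / of_nat ((vector [1, d2, d3] :: nat ^ 3) $ j)))
      - (\<Sum>j\<in>UNIV. Z $ k $ j * (of_real (of_rat (Q j i)) / of_nat ((vector [1, d2, d3] :: nat ^ 3) $ j)))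
      - (\<Sum>j\<in>UNIV. Z $ j $ i * (\<Sum>h\<in>UNIV. Z $ k $ h *
          (of_real (of_rat (P j h)) / of_nat ((vector [1, d2, d3] :: nat ^ 3) $ h)))
        / of_nat ((vector [1, d2, d3] :: nat ^ 3) $ j))" for i k
      unfolding of_real_of_rat using riem by blast
    show "T (e k) = (\<Sum>j\<in>UNIV. M $ j $ k *s e j)" for k
      using bspec[OF T_e, of "e k"] by (simp add: e_inj)
  qed (simp_all only: Rats_of_rat T.add T.scale M_def vec_lambda_beta of_real_of_rat)
  obtain k where "M $ k $ k \<noteq> 0" "\<forall>i j. M $ j $ i * M $ k $ k = M $ j $ k * M $ k $ i"
    using idempotent_trace_one_rank_one[OF M_idempotent[OF cube] t e2] by blast
  then obtain w z1 z2 where "w \<noteq> 0" "Im (cnj z1 * z2) \<noteq> 0" "z1 *s w \<in> \<Lambda>" "z2 *s w \<in> \<Lambda>"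
    using rank_one_imp_line[OF M_idempotent[OF cube], of k] by blast
  then show thesis by (rule that)
qed

theorem proposition4p5:
  fixes d2 d3 :: nat
    and \<Lambda> :: "(complex ^ 3) set"
    and H :: "complex ^ 3 \<Rightarrow> complex ^ 3 \<Rightarrow> complex"
    and Z :: "complex ^ 3 ^ 3"
  assumes "0 < d2" and "0 < d3" and "d2 dvd d3"
    and "polarized_abelian_variety \<Lambda> H"
    and "polarization_type \<Lambda> H (vector [1, d2, d3])"
    and "Z \<in> siegel_upper_half_space"
    and "has_period_matrix \<Lambda> H (vector [1, d2, d3]) (diag_matrix (vector [1, d2, d3])) Z"
  shows "(\<exists>E. elliptic_curve_in \<Lambda> E) \<longleftrightarrow>
         (\<exists>a :: nat \<Rightarrow> nat \<Rightarrow> rat.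
            elliptic_equations (of_nat d2) (of_nat d3) Z (\<lambda>i j. of_rat (a i j)))"
proof -
  have L: "is_lattice \<Lambda>" and pol: "polarization \<Lambda> H"
    using assms(4) unfolding polarized_abelian_variety_def by blast+
  from assms(7) obtain e :: "3 \<Rightarrow> complex ^ 3" where "inj e" "vec.independent (range e)"
      "vec.span (range e) = UNIV"
      "symplectic_basis \<Lambda> H (vector [1, d2, d3])
        (\<lambda>j. \<Sum>i\<in>UNIV. diag_matrix (vector [1, d2, d3]) $ i $ j *s e i) (\<lambda>j. \<Sum>i\<in>UNIV. Z $ i $ j *s e i)"
    unfolding has_period_matrix_def by blast
  moreover have "0 < (vector [1, d2, d3] :: nat ^ 3) $ i" for i
    using assms(1,2) exhaust_3[of i] by auto
  moreover have "transpose Z = Z"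
    using assms(6) unfolding siegel_upper_half_space_def by blast
  ultimately have pb: "period_basis \<Lambda> H (vector [1, d2, d3]) Z e"
    using L pol by unfold_locales
  show ?thesis
  proof
    assume "\<exists>E. elliptic_curve_in \<Lambda> E"
    then obtain E where "elliptic_curve_in \<Lambda> E" by blast
    with L obtain w z1 z2 where "w \<noteq> 0" "Im (cnj z1 * z2) \<noteq> 0" "z1 *s w \<in> \<Lambda>" "z2 *s w \<in> \<Lambda>"
      by (rule elliptic_curve_imp_line)
    with pb show "\<exists>a :: nat \<Rightarrow> nat \<Rightarrow> rat.
        elliptic_equations (of_nat d2) (of_nat d3) Z (\<lambda>i j. of_rat (a i j))"
      by (rule line_imp_equations)
  next
    assume "\<exists>a :: nat \<Rightarrow> nat \<Rightarrow> rat. elliptic_equations (of_nat d2) (of_nat d3) Z (\<lambda>i j. of_rat (a i j))"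
    then obtain a :: "nat \<Rightarrow> nat \<Rightarrow> rat"
      where "elliptic_equations (of_nat d2) (of_nat d3) Z (\<lambda>i j. of_rat (a i j))" by blast
    with pb obtain w z1 z2 where "w \<noteq> 0" "Im (cnj z1 * z2) \<noteq> 0" "z1 *s w \<in> \<Lambda>" "z2 *s w \<in> \<Lambda>"
      by (rule equations_imp_line)
    with L show "\<exists>E. elliptic_curve_in \<Lambda> E" by (rule line_imp_elliptic_curve)
  qed
qed

end
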